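(* For every constant specification $CS$, every set $\Gamma$ of closed formulas and every closed formula $\Phi$ of the language of $\mathit{FOLP}^\Box$: if $\Gamma\not\vdash_{CS}\Phi$, then there exist a Fitting model $\mathcal{M}$ meeting $CS$, a valuation $\nu$ for $\mathcal{M}$ and a world $w$ of $\mathcal{M}$ such that $(\mathcal{M},\nu),w\Vdash\Psi$ for every $\Psi\in\Gamma$ but $(\mathcal{M},\nu),w\not\Vdash\Phi$.
   Context: Language. Fix countably infinite sets $Var$ (individual variables), $JVar$ (justification variables), $JConst$ (justification constants), and infinitely many predicate symbols of each arity. Justification terms: $t ::= p \mid c \mid (t\cdot t)\mid (t+t)\mid\ !t \mid gen_x(t)$ with $p\in JVar$, $c\in JConst$, $x\in Var$ (the $x$ in $gen_x$ is only an index). Formulas: $P(x_1,\dots,x_n)$; $\neg\Phi$, $\Phi\wedge\Psi$, $\Phi\vee\Psi$, $\Phi\to\Psi$, $\Phi\leftrightarrow\Psi$, $\forall x\Phi$, $\exists x\Phi$; and, for every finite $X\subseteq Var$ and term $t$, $\Box_X\Phi$ and $t{:}_X\Phi$. Free/bound occurrences are as usual for first-order constructs; in $\Box_X\Phi$ and $t{:}_X\Phi$ bound occurrences stay bound, a free occurrence of $x$ in $\Phi$ stays free iff $x\in X$ (otherwise it becomes bound), and the variables in $X$ are free; so $FV(\Box_X\Phi)=FV(t{:}_X\Phi)=X$. A formula is closed if it has no free variables. Logic. $\mathit{FOLP}^\Box_0$ has axioms: (A0) classical first-order axioms; for $y\notin FV(\Phi)$: (A1) $t{:}_{X\cup\{y\}}\Phi\to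 t{:}_X\Phi$, (A1$'$) $\Box_{X\cup\{y\}}\Phi\to\Box_X\Phi$; (A2) $t{:}_X\Phi\to t{:}_{X\cup\{y\}}\Phi$, (A2$'$) $\Box_X\Phi\to\Box_{X\cup\{y\}}\Phi$; (A3) $t{:}_X\Phi\to\Phi$, (A3$'$) $\Box_X\Phi\to\Phi$; (A4) $t{:}_X(\Phi\to\Psi)\to(s{:}_X\Phi\to[t\cdot s]{:}_X\Psi)$, (A4$'$) $\Box_X(\Phi\to\Psi)\to(\Box_X\Phi\to\Box_X\Psi)$; (A5) $t{:}_X\Phi\to[t+s]{:}_X\Phi$, $s{:}_X\Phi\to[t+s]{:}_X\Phi$; (A6) $t{:}_X\Phi\to\ !t{:}_Xt{:}_X\Phi$, (A6$'$) $\Box_X\Phi\to\Box_X\Box_X\Phi$; for $x\notin X$: (A7) $t{:}_X\Phi\to gen_x(t){:}_X\forall x\Phi$, (A7$'$) $\Box_X\Phi\to\Box_X\forall x\Phi$; (A8) $t{:}_X\Phi\to\Box_X\Phi$. Rules: modus ponens, generalization ($\vdash\Phi\Rightarrow\vdash\forall x\Phi$), necessitation ($\vdash\Phi\Rightarrow\vdash\Box_\varnothing\Phi$). A constant specification $CS$ is a set of formulas $c{:}_\varnothing\Phi$ with $c\in JConst$ and $\Phi$ an axiom of $\mathit{FOLP}^\Box_0$; $\mathit{FOLP}^\Box_{CS}$ adds $CS$ as axioms. $\Gamma\vdash_{CS}\Phi$: $\Phi$ derivable in $\mathit{FOLP}^\Box_{CS}$ from hypotheses $\Gamma$, with generalization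 only on variables not free in $\Gamma$ and necessitation only applied to axioms of $\mathit{FOLP}^\Box_0$. Valuations. A valuation of an alphabet $X$ in $D$ is a function $f:X\to D$ (finite if $X$ finite). $f\upharpoonright Y$ is the restriction to $Y\cap Dom(f)$; $ext(f,D)$ the set of finite extensions $g\supseteq f$ with $Im(g)\subseteq D$; $f^{x_1,\dots,x_n}_{d_1,\dots,d_n}$ agrees with $f$ except $x_i\mapsto d_i$; $g\circ\sigma$ is $x\mapsto g(\sigma(x))$ for a variable substitution $\sigma$. Fitting model $\mathcal{M}=(W,R,(D_w)_{w\in W},I,\mathcal{E})$: $W\ne\varnothing$; $R$ reflexive and transitive; $D_w\ne\varnothing$ with $wRu\Rightarrow D_w\subseteq D_u$; $D=\bigcup_wD_w$; $I(P,w)\subseteq D_w^n$; $\mathcal{E}(t,\Phi,f)\subseteq W$ for each term $t$, formula $\Phi$, finite valuation $f$ of variables in $D$, satisfying: adequacy ($w\in\mathcal{E}(t,\Phi,f)\Rightarrow Im(f)\subseteq D_w$); substitution (if $\sigma$ replaces distinct $x_1,\dots,x_n\in FV(\Phi)$ by $y_1,\dots,y_n$ then $\mathcal{E}(t,\Phi\sigma,f\upharpoonright FV(\Phi\sigma))=\mathcal{E}(t,\Phi,f\circ\sigma)$); $R$-closure ($wRu$, $w\in\mathcal{E}(t,\Phi,f)\Rightarrow u\in\mathcal{E}(t,\Phi,f)$); extension ($w\in\mathcal{E}(t,\Phi,f)$, $g\in ext(f,D_w)\Rightarrow w\in\mathcal{E}(t,\Phi,g)$); restriction ($\mathcal{E}(t,\Phi,f)\subseteq\mathcal{E}(t,\Phi,f\upharpoonright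 FV(\Phi))$); $\mathcal{E}(t,\Phi\to\Psi,f)\cap\mathcal{E}(s,\Phi,f)\subseteq\mathcal{E}(t\cdot s,\Psi,f)$; $\mathcal{E}(t,\Phi,f)\cup\mathcal{E}(s,\Phi,f)\subseteq\mathcal{E}(t+s,\Phi,f)$; if $w\in\mathcal{E}(t,\Phi,f)$ then $w\in\mathcal{E}(!t,t{:}_X\Phi,g)$ for all $g\in ext(f,D_w)$ and $X$ with $Dom(f)\cap FV(\Phi)\subseteq X\subseteq Dom(g)$; $\mathcal{E}(t,\Phi,f)\subseteq\mathcal{E}(gen_x(t),\forall x\Phi,f)$ for $x\notin Dom(f)\cap FV(\Phi)$. $\mathcal{M}$ meets $CS$ if $c{:}_\varnothing\Phi\in CS$ implies $\mathcal{E}(c,\Phi,\varnothing)=W$. Truth. A valuation for $\mathcal{M}$ is $\nu:Var\to D$. $(\mathcal{M},\nu),w\Vdash P(x_1,\dots,x_n)$ iff $\langle\nu(x_1),\dots,\nu(x_n)\rangle\in I(P,w)$; $\Vdash\neg\Psi$ iff $\nu(FV(\Psi))\subseteq D_w$ and $\not\Vdash\Psi$; $\wedge$ as usual; $\Vdash\forall x\Psi$ iff $(\mathcal{M},\nu^x_a),w\Vdash\Psi$ for all $a\in D_w$ (other connectives and $\exists$ as standard abbreviations); $\Vdash\Box_X\Psi$ iff $\nu(X)\subseteq D_w$ and for all $u$ with $wRu$ and all $d_1,\dots,d_n\in D_u$, $(\mathcal{M},\nu^{y_1,\dots,y_n}_{d_1,\dots,d_n}),u\Vdash\Psi$ where $\{y_1,\dots,y_n\}=FV(\Psi)\setminus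 X$; $\Vdash t{:}_X\Psi$ iff the conditions for $\Box_X\Psi$ hold and $w\in\mathcal{E}(t,\Psi,\nu\upharpoonright(FV(\Psi)\cap X))$.
   Formalization: In the substitution condition on E, σ must be capture-free for Φ, f must be defined on each y_i that σ introduces, and f∘σ is restricted to FV(Φ); read literally for all partial f, the condition forces constant domains when CS is non-empty and the claim fails. *)

theory Defs
  imports Main "HOL-Library.FSet"
begin

section \<open>Language\<close>

type_synonym var = nat
type_synonym jvar = nat
type_synonym jconst = nat
type_synonym pname = nat

datatype jterm =
    JVar jvar
  | JConst jconst
  | App jterm jterm
  | Sum jterm jterm
  | Bang jterm
  | Gen var jterm

text \<open>
  A predicate symbol of arity \<open>n\<close> is a pair of a name and \<open>n\<close>; in \<open>Atom P xs\<close> the arity is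
  \<open>length xs\<close>, so every atom is well formed and there are infinitely many symbols of each arity.
  \<open>Box X A\<close> is \<open>\<box>\<^sub>X A\<close> and \<open>Just t X A\<close> is \<open>t:\<^sub>X A\<close>.
\<close>

datatype fm =
    Atom pname "var list"
  | Neg fm
  | Conj fm fm
  | Disj fm fm
  | Imp fm fm
  | Iff fm fm
  | All var fm
  | Ex var fm
  | Box "var fset" fm
  | Just jterm "var fset" fm

primrec FV :: "fm \<Rightarrow> var set" where
  "FV (Atom P xs) = set xs"
| "FV (Neg A) = FV A"
| "FV (Conj A B) = FV A \<union> FV B"
| "FV (Disj A B) = FV A \<union> FV B"
| "FV (Imp A B) = FV A \<union> FV B"
| "FV (Iff A B) = FV A \<union> FV B"
| "FV (All x A) = FV A - {x}"
| "FV (Ex x A) = FV A - {x}"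
| "FV (Box X A) = fset X"
| "FV (Just t X A) = fset X"

definition closed_fm :: "fm \<Rightarrow> bool" where
  "closed_fm A \<longleftrightarrow> FV A = {}"

text \<open>
  Simultaneous substitution of variables for free occurrences. A free occurrence in \<open>A\<close> of a
  variable outside \<open>X\<close> is bound in \<open>Box X A\<close> and \<open>Just t X A\<close>, hence left alone.
  Bound variables are not renamed; \<open>free_for\<close> says that no capture takes place.
\<close>

primrec subst :: "(var \<Rightarrow> var) \<Rightarrow> fm \<Rightarrow> fm" where
  "subst \<sigma> (Atom P xs) = Atom P (map \<sigma> xs)"
| "subst \<sigma> (Neg A) = Neg (subst \<sigma> A)"
| "subst \<sigma> (Conj A B) = Conj (subst \<sigma> A) (subst \<sigma> B)"
| "subst \<sigma> (Disj A B) = Disj (subst \<sigma> A) (subst \<sigma> B)"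
| "subst \<sigma> (Imp A B) = Imp (subst \<sigma> A) (subst \<sigma> B)"
| "subst \<sigma> (Iff A B) = Iff (subst \<sigma> A) (subst \<sigma> B)"
| "subst \<sigma> (All x A) = All x (subst (\<sigma>(x := x)) A)"
| "subst \<sigma> (Ex x A) = Ex x (subst (\<sigma>(x := x)) A)"
| "subst \<sigma> (Box X A) = Box (\<sigma> |`| X) (subst (\<lambda>x. if x |\<in>| X then \<sigma> x else x) A)"
| "subst \<sigma> (Just t X A) = Just t (\<sigma> |`| X) (subst (\<lambda>x. if x |\<in>| X then \<sigma> x else x) A)"

primrec free_for :: "(var \<Rightarrow> var) \<Rightarrow> fm \<Rightarrow> bool" where
  "free_for \<sigma> (Atom P xs) \<longleftrightarrow> True"
| "free_for \<sigma> (Neg A) \<longleftrightarrow> free_for \<sigma> A"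
| "free_for \<sigma> (Conj A B) \<longleftrightarrow> free_for \<sigma> A \<and> free_for \<sigma> B"
| "free_for \<sigma> (Disj A B) \<longleftrightarrow> free_for \<sigma> A \<and> free_for \<sigma> B"
| "free_for \<sigma> (Imp A B) \<longleftrightarrow> free_for \<sigma> A \<and> free_for \<sigma> B"
| "free_for \<sigma> (Iff A B) \<longleftrightarrow> free_for \<sigma> A \<and> free_for \<sigma> B"
| "free_for \<sigma> (All x A) \<longleftrightarrow> free_for (\<sigma>(x := x)) A \<and> x \<notin> \<sigma> ` (FV A - {x})"
| "free_for \<sigma> (Ex x A) \<longleftrightarrow> free_for (\<sigma>(x := x)) A \<and> x \<notin> \<sigma> ` (FV A - {x})"
| "free_for \<sigma> (Box X A) \<longleftrightarrow>
     free_for (\<lambda>x. if x |\<in>| X then \<sigma> x else x) A \<and> \<sigma> ` fset X \<inter> (FV A - fset X) = {}"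
| "free_for \<sigma> (Just t X A) \<longleftrightarrow>
     free_for (\<lambda>x. if x |\<in>| X then \<sigma> x else x) A \<and> \<sigma> ` fset X \<inter> (FV A - fset X) = {}"


section \<open>Logic\<close>

text \<open>Boolean evaluation, where \<open>b\<close> assigns truth values to the formulas that are not
  propositional compounds.\<close>

primrec beval :: "(fm \<Rightarrow> bool) \<Rightarrow> fm \<Rightarrow> bool" where
  "beval b (Atom P xs) \<longleftrightarrow> b (Atom P xs)"
| "beval b (Neg A) \<longleftrightarrow> \<not> beval b A"
| "beval b (Conj A B) \<longleftrightarrow> beval b A \<and> beval b B"
| "beval b (Disj A B) \<longleftrightarrow> beval b A \<or> beval b B"
| "beval b (Imp A B) \<longleftrightarrow> (beval b A \<longrightarrow> beval b B)"
| "beval b (Iff A B) \<longleftrightarrow> (beval b A \<longleftrightarrow> beval b B)"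
| "beval b (All x A) \<longleftrightarrow> b (All x A)"
| "beval b (Ex x A) \<longleftrightarrow> b (Ex x A)"
| "beval b (Box X A) \<longleftrightarrow> b (Box X A)"
| "beval b (Just t X A) \<longleftrightarrow> b (Just t X A)"

definition tautology :: "fm \<Rightarrow> bool" where
  "tautology A \<longleftrightarrow> (\<forall>b. beval b A)"

text \<open>The classical first-order axioms are all propositional tautologies together with the usual
  quantifier axioms for a calculus whose rules are modus ponens and generalization.\<close>

inductive fo_axiom :: "fm \<Rightarrow> bool" where
  Taut: "tautology A \<Longrightarrow> fo_axiom A"
| All_inst: "free_for (id(x := y)) A \<Longrightarrow> fo_axiom (Imp (All x A) (subst (id(x := y)) A))"
| Ex_intro: "free_for (id(x := y)) A \<Longrightarrow> fo_axiom (Imp (subst (id(x := y)) A) (Ex x A))"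
| All_dist: "x \<notin> FV A \<Longrightarrow> fo_axiom (Imp (All x (Imp A B)) (Imp A (All x B)))"
| Ex_dist: "x \<notin> FV B \<Longrightarrow> fo_axiom (Imp (All x (Imp A B)) (Imp (Ex x A) B))"

inductive folp_axiom :: "fm \<Rightarrow> bool" where
  A0: "fo_axiom A \<Longrightarrow> folp_axiom A"
| A1: "y \<notin> FV A \<Longrightarrow> folp_axiom (Imp (Just t (finsert y X) A) (Just t X A))"
| A1': "y \<notin> FV A \<Longrightarrow> folp_axiom (Imp (Box (finsert y X) A) (Box X A))"
| A2: "folp_axiom (Imp (Just t X A) (Just t (finsert y X) A))"
| A2': "folp_axiom (Imp (Box X A) (Box (finsert y X) A))"
| A3: "folp_axiom (Imp (Just t X A) A)"
| A3': "folp_axiom (Imp (Box X A) A)"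
| A4: "folp_axiom (Imp (Just t X (Imp A B)) (Imp (Just s X A) (Just (App t s) X B)))"
| A4': "folp_axiom (Imp (Box X (Imp A B)) (Imp (Box X A) (Box X B)))"
| A5_left: "folp_axiom (Imp (Just t X A) (Just (Sum t s) X A))"
| A5_right: "folp_axiom (Imp (Just s X A) (Just (Sum t s) X A))"
| A6: "folp_axiom (Imp (Just t X A) (Just (Bang t) X (Just t X A)))"
| A6': "folp_axiom (Imp (Box X A) (Box X (Box X A)))"
| A7: "x |\<notin>| X \<Longrightarrow> folp_axiom (Imp (Just t X A) (Just (Gen x t) X (All x A)))"
| A7': "x |\<notin>| X \<Longrightarrow> folp_axiom (Imp (Box X A) (Box X (All x A)))"
| A8: "folp_axiom (Imp (Just t X A) (Box X A))"

definition const_spec :: "fm set \<Rightarrow> bool" where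
  "const_spec CS \<longleftrightarrow> CS \<subseteq> {Just (JConst c) {||} A | c A. folp_axiom A}"

inductive derives :: "fm set \<Rightarrow> fm set \<Rightarrow> fm \<Rightarrow> bool" for CS :: "fm set" and \<Gamma> :: "fm set" where
  Hyp: "A \<in> \<Gamma> \<Longrightarrow> derives CS \<Gamma> A"
| Axiom: "folp_axiom A \<Longrightarrow> derives CS \<Gamma> A"
| ConstSpec: "A \<in> CS \<Longrightarrow> derives CS \<Gamma> A"
| MP: "derives CS \<Gamma> (Imp A B) \<Longrightarrow> derives CS \<Gamma> A \<Longrightarrow> derives CS \<Gamma> B"
| Generalization: "derives CS \<Gamma> A \<Longrightarrow> \<forall>B\<in>\<Gamma>. x \<notin> FV B \<Longrightarrow> derives CS \<Gamma> (All x A)"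
| Necessitation: "folp_axiom A \<Longrightarrow> derives CS \<Gamma> (Box {||} A)"


section \<open>Fitting models\<close>

text \<open>\<open>Intp M P n w\<close> interprets the \<open>n\<close>-ary predicate symbol named \<open>P\<close> at \<open>w\<close>. Partial
  valuations are maps; \<open>Evid M t A f\<close> is only constrained for finite valuations \<open>f\<close> in the
  domain of \<open>M\<close>.\<close>

record ('w, 'd) fmodel =
  Worlds :: "'w set"
  Acc :: "('w \<times> 'w) set"
  Dm :: "'w \<Rightarrow> 'd set"
  Intp :: "pname \<Rightarrow> nat \<Rightarrow> 'w \<Rightarrow> 'd list set"
  Evid :: "jterm \<Rightarrow> fm \<Rightarrow> (var \<rightharpoonup> 'd) \<Rightarrow> 'w set"

definition Domain_of :: "('w, 'd) fmodel \<Rightarrow> 'd set" where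
  "Domain_of M = (\<Union>w\<in>Worlds M. Dm M w)"

definition fin_val :: "'d set \<Rightarrow> (var \<rightharpoonup> 'd) \<Rightarrow> bool" where
  "fin_val D f \<longleftrightarrow> finite (dom f) \<and> ran f \<subseteq> D"

definition ext :: "(var \<rightharpoonup> 'd) \<Rightarrow> 'd set \<Rightarrow> (var \<rightharpoonup> 'd) set" where
  "ext f D = {g. fin_val D g \<and> f \<subseteq>\<^sub>m g}"

definition frame_cond :: "('w, 'd) fmodel \<Rightarrow> bool" where
  "frame_cond M \<longleftrightarrow>
     Worlds M \<noteq> {} \<and>
     Acc M \<subseteq> Worlds M \<times> Worlds M \<and> refl_on (Worlds M) (Acc M) \<and> trans (Acc M) \<and>
     (\<forall>w\<in>Worlds M. Dm M w \<noteq> {}) \<and>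
     (\<forall>w u. (w, u) \<in> Acc M \<longrightarrow> Dm M w \<subseteq> Dm M u) \<and>
     (\<forall>P n. \<forall>w\<in>Worlds M. Intp M P n w \<subseteq> {ds. length ds = n \<and> set ds \<subseteq> Dm M w})"

definition adequacy_cond :: "('w, 'd) fmodel \<Rightarrow> bool" where
  "adequacy_cond M \<longleftrightarrow> (\<forall>t A f. fin_val (Domain_of M) f \<longrightarrow>
     Evid M t A f \<subseteq> {w \<in> Worlds M. ran f \<subseteq> Dm M w})"

text \<open>
  The variables replaced by \<open>\<sigma>\<close> are the \<open>x\<close> with \<open>\<sigma> x \<noteq> x\<close>. The composition of \<open>f\<close> with \<open>\<sigma>\<close> is
  read as a valuation of the free variables of \<open>A\<close>, and it has to be defined on all replaced
  variables. Without the restriction to \<open>FV A\<close>, adequacy would force a constant domain as soon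
  as there is evidence at every world. Without the definedness condition, taking \<open>f\<close> empty would
  validate the implication from \<open>t:\<^sub>\<emptyset> P(x,y)\<close> to \<open>t:\<^sub>\<emptyset> P(z,z)\<close>, which is not derivable.
\<close>

definition substitution_cond :: "('w, 'd) fmodel \<Rightarrow> bool" where
  "substitution_cond M \<longleftrightarrow> (\<forall>t A f \<sigma>. fin_val (Domain_of M) f \<and>
     {x. \<sigma> x \<noteq> x} \<subseteq> FV A \<and> free_for \<sigma> A \<and> \<sigma> ` {x. \<sigma> x \<noteq> x} \<subseteq> dom f \<longrightarrow>
     Evid M t (subst \<sigma> A) (f |` FV (subst \<sigma> A)) = Evid M t A ((f \<circ> \<sigma>) |` FV A))"

definition R_closure_cond :: "('w, 'd) fmodel \<Rightarrow> bool" where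
  "R_closure_cond M \<longleftrightarrow> (\<forall>t A f w u. fin_val (Domain_of M) f \<and>
     (w, u) \<in> Acc M \<and> w \<in> Evid M t A f \<longrightarrow> u \<in> Evid M t A f)"

definition extension_cond :: "('w, 'd) fmodel \<Rightarrow> bool" where
  "extension_cond M \<longleftrightarrow> (\<forall>t A f w g. fin_val (Domain_of M) f \<and>
     w \<in> Evid M t A f \<and> g \<in> ext f (Dm M w) \<longrightarrow> w \<in> Evid M t A g)"

definition restriction_cond :: "('w, 'd) fmodel \<Rightarrow> bool" where
  "restriction_cond M \<longleftrightarrow> (\<forall>t A f. fin_val (Domain_of M) f \<longrightarrow>
     Evid M t A f \<subseteq> Evid M t A (f |` FV A))"

definition app_cond :: "('w, 'd) fmodel \<Rightarrow> bool" where
  "app_cond M \<longleftrightarrow> (\<forall>t s A B f. fin_val (Domain_of M) f \<longrightarrow>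
     Evid M t (Imp A B) f \<inter> Evid M s A f \<subseteq> Evid M (App t s) B f)"

definition sum_cond :: "('w, 'd) fmodel \<Rightarrow> bool" where
  "sum_cond M \<longleftrightarrow> (\<forall>t s A f. fin_val (Domain_of M) f \<longrightarrow>
     Evid M t A f \<union> Evid M s A f \<subseteq> Evid M (Sum t s) A f)"

definition bang_cond :: "('w, 'd) fmodel \<Rightarrow> bool" where
  "bang_cond M \<longleftrightarrow> (\<forall>t A f w g X. fin_val (Domain_of M) f \<and> w \<in> Evid M t A f \<and>
     g \<in> ext f (Dm M w) \<and> dom f \<inter> FV A \<subseteq> fset X \<and> fset X \<subseteq> dom g \<longrightarrow>
     w \<in> Evid M (Bang t) (Just t X A) g)"

definition gen_cond :: "('w, 'd) fmodel \<Rightarrow> bool" where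
  "gen_cond M \<longleftrightarrow> (\<forall>t A f x. fin_val (Domain_of M) f \<and> x \<notin> dom f \<inter> FV A \<longrightarrow>
     Evid M t A f \<subseteq> Evid M (Gen x t) (All x A) f)"

definition fitting_model :: "('w, 'd) fmodel \<Rightarrow> bool" where
  "fitting_model M \<longleftrightarrow>
     frame_cond M \<and> adequacy_cond M \<and> substitution_cond M \<and> R_closure_cond M \<and>
     extension_cond M \<and> restriction_cond M \<and> app_cond M \<and> sum_cond M \<and> bang_cond M \<and>
     gen_cond M"

definition meets :: "('w, 'd) fmodel \<Rightarrow> fm set \<Rightarrow> bool" where
  "meets M CS \<longleftrightarrow>
     (\<forall>c A. Just (JConst c) {||} A \<in> CS \<longrightarrow> Evid M (JConst c) A Map.empty = Worlds M)"

definition valuation :: "('w, 'd) fmodel \<Rightarrow> (var \<Rightarrow> 'd) \<Rightarrow> bool" where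
  "valuation M \<nu> \<longleftrightarrow> range \<nu> \<subseteq> Domain_of M"

text \<open>\<open>variants \<nu> Y D\<close> is the set of valuations obtained from \<open>\<nu>\<close> by changing its values on
  \<open>Y\<close> to arbitrary elements of \<open>D\<close>.\<close>

definition variants :: "(var \<Rightarrow> 'd) \<Rightarrow> var set \<Rightarrow> 'd set \<Rightarrow> (var \<Rightarrow> 'd) set" where
  "variants \<nu> Y D = {\<mu>. (\<forall>y\<in>Y. \<mu> y \<in> D) \<and> (\<forall>x. x \<notin> Y \<longrightarrow> \<mu> x = \<nu> x)}"

primrec sat :: "('w, 'd) fmodel \<Rightarrow> (var \<Rightarrow> 'd) \<Rightarrow> 'w \<Rightarrow> fm \<Rightarrow> bool" where
  "sat M \<nu> w (Atom P xs) \<longleftrightarrow> map \<nu> xs \<in> Intp M P (length xs) w"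
| "sat M \<nu> w (Neg A) \<longleftrightarrow> \<nu> ` FV A \<subseteq> Dm M w \<and> \<not> sat M \<nu> w A"
| "sat M \<nu> w (Conj A B) \<longleftrightarrow> sat M \<nu> w A \<and> sat M \<nu> w B"
| "sat M \<nu> w (Disj A B) \<longleftrightarrow>
     \<nu> ` (FV A \<union> FV B) \<subseteq> Dm M w \<and> (sat M \<nu> w A \<or> sat M \<nu> w B)"
| "sat M \<nu> w (Imp A B) \<longleftrightarrow>
     \<nu> ` (FV A \<union> FV B) \<subseteq> Dm M w \<and> (sat M \<nu> w A \<longrightarrow> sat M \<nu> w B)"
| "sat M \<nu> w (Iff A B) \<longleftrightarrow>
     \<nu> ` (FV A \<union> FV B) \<subseteq> Dm M w \<and> (sat M \<nu> w A \<longleftrightarrow> sat M \<nu> w B)"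
| "sat M \<nu> w (All x A) \<longleftrightarrow> (\<forall>a\<in>Dm M w. sat M (\<nu>(x := a)) w A)"
| "sat M \<nu> w (Ex x A) \<longleftrightarrow>
     \<nu> ` (FV A - {x}) \<subseteq> Dm M w \<and> (\<exists>a\<in>Dm M w. sat M (\<nu>(x := a)) w A)"
| "sat M \<nu> w (Box X A) \<longleftrightarrow>
     \<nu> ` fset X \<subseteq> Dm M w \<and>
     (\<forall>u. (w, u) \<in> Acc M \<longrightarrow> (\<forall>\<mu>\<in>variants \<nu> (FV A - fset X) (Dm M u). sat M \<mu> u A))"
| "sat M \<nu> w (Just t X A) \<longleftrightarrow>
     (\<nu> ` fset X \<subseteq> Dm M w \<and>
      (\<forall>u. (w, u) \<in> Acc M \<longrightarrow> (\<forall>\<mu>\<in>variants \<nu> (FV A - fset X) (Dm M u). sat M \<mu> u A))) \<and>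
     w \<in> Evid M t A ((Some \<circ> \<nu>) |` (FV A \<inter> fset X))"

text \<open>The clauses for the remaining connectives are those of the standard abbreviations.\<close>

lemma sat_abbreviations:
  "sat M \<nu> w (Disj A B) \<longleftrightarrow> sat M \<nu> w (Neg (Conj (Neg A) (Neg B)))"
  "sat M \<nu> w (Imp A B) \<longleftrightarrow> sat M \<nu> w (Neg (Conj A (Neg B)))"
  "sat M \<nu> w (Iff A B) \<longleftrightarrow> sat M \<nu> w (Conj (Imp A B) (Imp B A))"
  "sat M \<nu> w (Ex x A) \<longleftrightarrow> sat M \<nu> w (Neg (All x (Neg A)))"
  by (auto simp: image_subset_iff)

end

theory Submission
  imports Defs "HOL-Library.Countable" "HOL-Library.Infinite_Set"
begin

text \<open>
  A canonical model. There is no alpha-conversion under a justification term, so bound variables and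
  domain elements must be kept apart: the original formulas are embedded by an injective renaming
  \<open>\<rho>\<close> of their variables, and the variables outside the range of \<open>\<rho>\<close>, the parameters, serve as
  witnesses. Derivability is reflected by this embedding because a derivation uses finitely many
  members of \<open>CS\<close>, and on their variables \<open>\<rho>\<close> has an injective left inverse.

  Worlds are maximal consistent Henkin sets whose free variables are parameters, with infinitely
  many parameters left over; their free variables form the domain. A world accesses another if its
  domain and its boxed formulas are preserved. A world is in the evidence set of \<open>t\<close>, \<open>A\<close>, \<open>f\<close> if it
  contains \<open>t:\<^sub>Y A\<close> with the free variables of \<open>A\<close> valued by \<open>f\<close> and \<open>Y\<close> the set of their values.
  The extension condition holds because (A2) does not require the new variable to be absent from the
  formula.
\<close>

section \<open>Renaming of variables\<close>

lemma fm_induct_grouped [case_names Atom Neg Binary Quantifier Modality]: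
  assumes "\<And>p xs. P (Atom p xs)"
    and "\<And>A. P A \<Longrightarrow> P (Neg A)"
    and "\<And>conn A B. conn \<in> {Conj, Disj, Imp, Iff} \<Longrightarrow> P A \<Longrightarrow> P B \<Longrightarrow> P (conn A B)"
    and "\<And>Q x A. Q \<in> {All, Ex} \<Longrightarrow> P A \<Longrightarrow> P (Q x A)"
    and "\<And>M X A. M \<in> insert Box (range Just) \<Longrightarrow> P A \<Longrightarrow> P (M X A)"
  shows "P A"
  using assms by (induction A) auto

lemma finite_FV: "finite (FV A)"
  by (induction A) auto

lemma obtain_fset:
  assumes "finite S"
  obtains X where "fset X = S"
  using assms that[of "Abs_fset S"] by (simp add: Abs_fset_inverse)

lemma obtain_fset_FV_Int:
  obtains X where "fset X = FV A \<inter> S"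
  by (rule obtain_fset[OF finite_Int[OF disjI1[OF finite_FV]]])

primrec vars_term :: "jterm \<Rightarrow> var set" where
  "vars_term (JVar p) = {}"
| "vars_term (JConst c) = {}"
| "vars_term (App t s) = vars_term t \<union> vars_term s"
| "vars_term (Sum t s) = vars_term t \<union> vars_term s"
| "vars_term (Bang t) = vars_term t"
| "vars_term (Gen x t) = insert x (vars_term t)"

primrec vars :: "fm \<Rightarrow> var set" where
  "vars (Atom P xs) = set xs"
| "vars (Neg A) = vars A"
| "vars (Conj A B) = vars A \<union> vars B"
| "vars (Disj A B) = vars A \<union> vars B"
| "vars (Imp A B) = vars A \<union> vars B"
| "vars (Iff A B) = vars A \<union> vars B"
| "vars (All x A) = insert x (vars A)"
| "vars (Ex x A) = insert x (vars A)"
| "vars (Box X A) = fset X \<union> vars A"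
| "vars (Just t X A) = vars_term t \<union> fset X \<union> vars A"

lemma finite_vars_term: "finite (vars_term t)"
  by (induction t) auto

lemma finite_vars: "finite (vars A)"
  by (induction A) (auto simp: finite_vars_term)

lemma FV_subset_vars: "FV A \<subseteq> vars A"
  by (induction A) auto

primrec ren_term :: "(var \<Rightarrow> var) \<Rightarrow> jterm \<Rightarrow> jterm" where
  "ren_term \<rho> (JVar p) = JVar p"
| "ren_term \<rho> (JConst c) = JConst c"
| "ren_term \<rho> (App t s) = App (ren_term \<rho> t) (ren_term \<rho> s)"
| "ren_term \<rho> (Sum t s) = Sum (ren_term \<rho> t) (ren_term \<rho> s)"
| "ren_term \<rho> (Bang t) = Bang (ren_term \<rho> t)"
| "ren_term \<rho> (Gen x t) = Gen (\<rho> x) (ren_term \<rho> t)"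

text \<open>\<open>\<rho>\<close> acts on bound variables, including those bound by a modality and the indices of \<open>Gen\<close>;
  \<open>\<sigma>\<close> acts on free ones.\<close>

primrec ren :: "(var \<Rightarrow> var) \<Rightarrow> (var \<Rightarrow> var) \<Rightarrow> fm \<Rightarrow> fm" where
  "ren \<rho> \<sigma> (Atom P xs) = Atom P (map \<sigma> xs)"
| "ren \<rho> \<sigma> (Neg A) = Neg (ren \<rho> \<sigma> A)"
| "ren \<rho> \<sigma> (Conj A B) = Conj (ren \<rho> \<sigma> A) (ren \<rho> \<sigma> B)"
| "ren \<rho> \<sigma> (Disj A B) = Disj (ren \<rho> \<sigma> A) (ren \<rho> \<sigma> B)"
| "ren \<rho> \<sigma> (Imp A B) = Imp (ren \<rho> \<sigma> A) (ren \<rho> \<sigma> B)"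
| "ren \<rho> \<sigma> (Iff A B) = Iff (ren \<rho> \<sigma> A) (ren \<rho> \<sigma> B)"
| "ren \<rho> \<sigma> (All x A) = All (\<rho> x) (ren \<rho> (\<sigma>(x := \<rho> x)) A)"
| "ren \<rho> \<sigma> (Ex x A) = Ex (\<rho> x) (ren \<rho> (\<sigma>(x := \<rho> x)) A)"
| "ren \<rho> \<sigma> (Box X A) = Box (\<sigma> |`| X) (ren \<rho> (override_on \<rho> \<sigma> (fset X)) A)"
| "ren \<rho> \<sigma> (Just t X A) =
     Just (ren_term \<rho> t) (\<sigma> |`| X) (ren \<rho> (override_on \<rho> \<sigma> (fset X)) A)"

primrec no_capture :: "(var \<Rightarrow> var) \<Rightarrow> (var \<Rightarrow> var) \<Rightarrow> fm \<Rightarrow> bool" where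
  "no_capture \<rho> \<sigma> (Atom P xs) \<longleftrightarrow> True"
| "no_capture \<rho> \<sigma> (Neg A) \<longleftrightarrow> no_capture \<rho> \<sigma> A"
| "no_capture \<rho> \<sigma> (Conj A B) \<longleftrightarrow> no_capture \<rho> \<sigma> A \<and> no_capture \<rho> \<sigma> B"
| "no_capture \<rho> \<sigma> (Disj A B) \<longleftrightarrow> no_capture \<rho> \<sigma> A \<and> no_capture \<rho> \<sigma> B"
| "no_capture \<rho> \<sigma> (Imp A B) \<longleftrightarrow> no_capture \<rho> \<sigma> A \<and> no_capture \<rho> \<sigma> B"
| "no_capture \<rho> \<sigma> (Iff A B) \<longleftrightarrow> no_capture \<rho> \<sigma> A \<and> no_capture \<rho> \<sigma> B"
| "no_capture \<rho> \<sigma> (All x A) \<longleftrightarrow> no_capture \<rho> (\<sigma>(x := \<rho> x)) A \<and> (\<forall>z\<in>FV A - {x}. \<sigma> z \<noteq> \<rho> x)"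
| "no_capture \<rho> \<sigma> (Ex x A) \<longleftrightarrow> no_capture \<rho> (\<sigma>(x := \<rho> x)) A \<and> (\<forall>z\<in>FV A - {x}. \<sigma> z \<noteq> \<rho> x)"
| "no_capture \<rho> \<sigma> (Box X A) \<longleftrightarrow>
     no_capture \<rho> (override_on \<rho> \<sigma> (fset X)) A \<and>
     (\<forall>z\<in>fset X. \<forall>y\<in>FV A - fset X. \<rho> y \<noteq> \<sigma> z)"
| "no_capture \<rho> \<sigma> (Just t X A) \<longleftrightarrow>
     no_capture \<rho> (override_on \<rho> \<sigma> (fset X)) A \<and>
     (\<forall>z\<in>fset X. \<forall>y\<in>FV A - fset X. \<rho> y \<noteq> \<sigma> z)"

lemma ren_term_cong: "(\<And>x. x \<in> vars_term t \<Longrightarrow> \<rho> x = \<rho>' x) \<Longrightarrow> ren_term \<rho> t = ren_term \<rho>' t"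
  by (induction t) auto

lemma ren_term_id [simp]: "ren_term id t = t"
  by (induction t) auto

lemma ren_term_comp: "ren_term \<rho> (ren_term \<rho>' t) = ren_term (\<rho> \<circ> \<rho>') t"
  by (induction t) auto

lemma override_on_same [simp]: "override_on f f S = f"
  by (simp add: override_on_def)

lemma subst_eq_ren: "subst \<sigma> A = ren id \<sigma> A"
  by (induction A arbitrary: \<sigma>) (simp_all add: override_on_def cong: if_cong)

lemma free_for_iff_no_capture: "free_for \<sigma> A \<longleftrightarrow> no_capture id \<sigma> A"
  by (induction A arbitrary: \<sigma>) (auto simp: override_on_def cong: if_cong)

lemma ren_id: "ren id id A = A"
  by (induction A) (simp_all del: id_apply, simp_all)

lemma ren_cong:
  assumes "\<And>x. x \<in> vars A \<Longrightarrow> \<rho> x = \<rho>' x" and "\<And>x. x \<in> FV A \<Longrightarrow> \<sigma> x = \<sigma>' x"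
  shows "ren \<rho> \<sigma> A = ren \<rho>' \<sigma>' A"
  using assms
proof (induction A arbitrary: \<sigma> \<sigma>' rule: fm_induct_grouped)
  case (Binary conn A B)
  have "ren \<rho> \<sigma> A = ren \<rho>' \<sigma>' A" "ren \<rho> \<sigma> B = ren \<rho>' \<sigma>' B"
    using Binary.hyps Binary.prems by (auto intro!: Binary.IH)
  then show ?case using Binary.hyps by auto
next
  case (Quantifier Q x A)
  have "ren \<rho> (\<sigma>(x := \<rho> x)) A = ren \<rho>' (\<sigma>'(x := \<rho>' x)) A"
    using Quantifier.hyps Quantifier.prems by (intro Quantifier.IH) auto
  moreover have "\<rho> x = \<rho>' x" using Quantifier.hyps Quantifier.prems(1) by auto
  ultimately show ?case using Quantifier.hyps by auto
next
  case (Modality M X A)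
  have "ren \<rho> (override_on \<rho> \<sigma> (fset X)) A = ren \<rho>' (override_on \<rho>' \<sigma>' (fset X)) A"
    using Modality.hyps Modality.prems subsetD[OF FV_subset_vars[of A]]
    by (intro Modality.IH) (auto simp: override_on_def)
  moreover have "\<sigma> |`| X = \<sigma>' |`| X"
    using Modality.hyps Modality.prems(2) by (intro fset.map_cong) auto
  moreover have "ren_term \<rho> t = ren_term \<rho>' t" if "M = Just t" for t
    using that Modality.prems(1) by (intro ren_term_cong) auto
  ultimately show ?case using Modality.hyps by auto
qed auto

lemma ren_free_cong: "(\<And>x. x \<in> FV A \<Longrightarrow> \<sigma> x = \<sigma>' x) \<Longrightarrow> ren \<rho> \<sigma> A = ren \<rho> \<sigma>' A"
  by (rule ren_cong) auto

lemma ren_ident: "(\<And>x. x \<in> vars A \<Longrightarrow> \<rho> x = x) \<Longrightarrow> (\<And>x. x \<in> FV A \<Longrightarrow> \<sigma> x = x) \<Longrightarrow> ren \<rho> \<sigma> A = A"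
  using ren_cong[of A \<rho> id \<sigma> id] by (simp add: ren_id)

lemma no_capture_cong:
  assumes "\<And>x. x \<in> FV A \<Longrightarrow> \<sigma> x = \<sigma>' x"
  shows "no_capture \<rho> \<sigma> A \<longleftrightarrow> no_capture \<rho> \<sigma>' A"
  using assms
proof (induction A arbitrary: \<sigma> \<sigma>' rule: fm_induct_grouped)
  case (Neg A)
  show ?case using Neg.IH[of \<sigma> \<sigma>'] Neg.prems by simp
next
  case (Binary conn A B)
  have "no_capture \<rho> \<sigma> A \<longleftrightarrow> no_capture \<rho> \<sigma>' A"
    by (rule Binary.IH(1)) (use Binary.hyps Binary.prems in auto)
  moreover have "no_capture \<rho> \<sigma> B \<longleftrightarrow> no_capture \<rho> \<sigma>' B"
    by (rule Binary.IH(2)) (use Binary.hyps Binary.prems in auto)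
  ultimately show ?case using Binary.hyps by auto
next
  case (Quantifier Q x A)
  have "no_capture \<rho> (\<sigma>(x := \<rho> x)) A \<longleftrightarrow> no_capture \<rho> (\<sigma>'(x := \<rho> x)) A"
    by (rule Quantifier.IH) (use Quantifier.hyps Quantifier.prems in auto)
  moreover have "\<forall>z\<in>FV A - {x}. \<sigma> z = \<sigma>' z"
    by (intro ballI Quantifier.prems) (use Quantifier.hyps in auto)
  ultimately show ?case using Quantifier.hyps by auto
next
  case (Modality M X A)
  have "no_capture \<rho> (override_on \<rho> \<sigma> (fset X)) A \<longleftrightarrow> no_capture \<rho> (override_on \<rho> \<sigma>' (fset X)) A"
    by (rule Modality.IH) (use Modality.hyps Modality.prems in \<open>auto simp: override_on_def\<close>)
  moreover have "\<forall>z\<in>fset X. \<sigma> z = \<sigma>' z" using Modality.hyps Modality.prems by auto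
  ultimately show ?case using Modality.hyps by auto
qed simp

lemma no_captureI:
  assumes "inj_on \<rho> (vars A)" and "\<And>x y. x \<in> FV A \<Longrightarrow> y \<in> vars A \<Longrightarrow> x \<noteq> y \<Longrightarrow> \<sigma> x \<noteq> \<rho> y"
  shows "no_capture \<rho> \<sigma> A"
  using assms
proof (induction A arbitrary: \<sigma> rule: fm_induct_grouped)
  case (Binary conn A B)
  then have "no_capture \<rho> \<sigma> A" "no_capture \<rho> \<sigma> B"
    by (auto intro!: Binary.IH simp: inj_on_Un)
  then show ?case using Binary.hyps by auto
next
  case (Quantifier Q x A)
  have inj: "inj_on \<rho> (insert x (vars A))" using Quantifier.hyps Quantifier.prems(1) by auto
  then have "no_capture \<rho> (\<sigma>(x := \<rho> x)) A"
    using Quantifier.hyps Quantifier.prems(2)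
    by (intro Quantifier.IH) (auto simp: inj_on_def)
  then show ?case using Quantifier.hyps Quantifier.prems(2) FV_subset_vars[of A] by fastforce
next
  case (Modality M X A)
  have inj: "inj_on \<rho> (vars A)" using Modality.hyps Modality.prems(1) by (auto simp: inj_on_Un)
  have apart: "\<rho> y \<noteq> \<sigma> x" if "x |\<in>| X" "y \<in> vars A" "x \<noteq> y" for x y
    using Modality.hyps Modality.prems(2)[of x y] that by auto
  have "no_capture \<rho> (override_on \<rho> \<sigma> (fset X)) A"
    using inj apart apart[symmetric] FV_subset_vars[of A]
    by (intro Modality.IH) (auto simp: override_on_def inj_on_def)
  moreover have "\<forall>z\<in>fset X. \<forall>y\<in>FV A - fset X. \<rho> y \<noteq> \<sigma> z"
    using apart FV_subset_vars[of A] by auto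
  ultimately show ?case using Modality.hyps by auto
qed auto

lemma no_capture_inj: "inj \<rho> \<Longrightarrow> no_capture \<rho> \<rho> A"
  by (rule no_captureI) (auto simp: inj_def inj_on_def)

lemma free_for_fresh: "v \<notin> vars A \<Longrightarrow> free_for (id(x := v)) A"
  unfolding free_for_iff_no_capture by (rule no_captureI) auto

lemma free_for_self: "free_for (id(x := x)) A"
  unfolding free_for_iff_no_capture by (rule no_captureI) auto

lemma subst_self: "subst (id(x := x)) A = A"
  unfolding subst_eq_ren by (rule ren_ident) auto

lemma FV_ren: "no_capture \<rho> \<sigma> A \<Longrightarrow> FV (ren \<rho> \<sigma> A) = \<sigma> ` FV A"
proof (induction A arbitrary: \<sigma> rule: fm_induct_grouped)
  case (Quantifier Q x A)
  have body: "no_capture \<rho> (\<sigma>(x := \<rho> x)) A"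
    and apart: "\<And>z. z \<in> FV A \<Longrightarrow> z \<noteq> x \<Longrightarrow> \<sigma> z \<noteq> \<rho> x"
    using Quantifier.hyps Quantifier.prems by auto
  have "FV (ren \<rho> (\<sigma>(x := \<rho> x)) A) - {\<rho> x} = \<sigma> ` (FV A - {x})"
    unfolding Quantifier.IH[OF body] using apart by (auto split: if_splits)
  then show ?case using Quantifier.hyps by auto
qed auto

lemma FV_ren_inj: "inj \<rho> \<Longrightarrow> FV (ren \<rho> \<rho> A) = \<rho> ` FV A"
  by (simp add: FV_ren no_capture_inj)

lemma FV_subst: "free_for \<sigma> A \<Longrightarrow> FV (subst \<sigma> A) = \<sigma> ` FV A"
  by (simp add: subst_eq_ren free_for_iff_no_capture FV_ren)

lemma ren_ren: "no_capture \<rho>' \<sigma>' A \<Longrightarrow> ren \<rho> \<sigma> (ren \<rho>' \<sigma>' A) = ren (\<rho> \<circ> \<rho>') (\<sigma> \<circ> \<sigma>') A"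
proof (induction A arbitrary: \<sigma> \<sigma>' rule: fm_induct_grouped)
  case (Quantifier Q x A)
  let ?\<sigma> = "\<sigma>(\<rho>' x := \<rho> (\<rho>' x))" and ?\<sigma>' = "\<sigma>'(x := \<rho>' x)"
  have body: "no_capture \<rho>' ?\<sigma>' A"
    and apart: "\<And>z. z \<in> FV A \<Longrightarrow> z \<noteq> x \<Longrightarrow> \<sigma>' z \<noteq> \<rho>' x"
    using Quantifier.hyps Quantifier.prems by auto
  have "ren \<rho> ?\<sigma> (ren \<rho>' ?\<sigma>' A) = ren (\<rho> \<circ> \<rho>') (?\<sigma> \<circ> ?\<sigma>') A"
    by (rule Quantifier.IH[OF body])
  also have "\<dots> = ren (\<rho> \<circ> \<rho>') ((\<sigma> \<circ> \<sigma>')(x := (\<rho> \<circ> \<rho>') x)) A"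
    by (rule ren_free_cong) (simp add: apart)
  finally show ?case using Quantifier.hyps by (auto simp: comp_def)
next
  case (Modality M X A)
  let ?\<sigma> = "override_on \<rho> \<sigma> (\<sigma>' ` fset X)" and ?\<sigma>' = "override_on \<rho>' \<sigma>' (fset X)"
  have body: "no_capture \<rho>' ?\<sigma>' A"
    and apart: "\<And>z y. z |\<in>| X \<Longrightarrow> y \<in> FV A \<Longrightarrow> y |\<notin>| X \<Longrightarrow> \<rho>' y \<noteq> \<sigma>' z"
    using Modality.hyps Modality.prems by auto
  have "ren \<rho> ?\<sigma> (ren \<rho>' ?\<sigma>' A) = ren (\<rho> \<circ> \<rho>') (?\<sigma> \<circ> ?\<sigma>') A"
    by (rule Modality.IH[OF body])
  also have "\<dots> = ren (\<rho> \<circ> \<rho>') (override_on (\<rho> \<circ> \<rho>') (\<sigma> \<circ> \<sigma>') (fset X)) A"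
    using apart by (intro ren_free_cong) (auto simp: override_on_def)
  finally show ?case using Modality.hyps by (auto simp: fset.map_comp ren_term_comp comp_def)
qed auto

lemma no_capture_ren:
  "no_capture \<rho>' \<sigma>' A \<Longrightarrow>
    no_capture \<rho> \<sigma> (ren \<rho>' \<sigma>' A) \<longleftrightarrow> no_capture (\<rho> \<circ> \<rho>') (\<sigma> \<circ> \<sigma>') A"
proof (induction A arbitrary: \<sigma> \<sigma>' rule: fm_induct_grouped)
  case (Quantifier Q x A)
  let ?\<sigma> = "\<sigma>(\<rho>' x := \<rho> (\<rho>' x))" and ?\<sigma>' = "\<sigma>'(x := \<rho>' x)"
  have body: "no_capture \<rho>' ?\<sigma>' A"
    and apart: "\<And>z. z \<in> FV A \<Longrightarrow> z \<noteq> x \<Longrightarrow> \<sigma>' z \<noteq> \<rho>' x"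
    using Quantifier.hyps Quantifier.prems by auto
  have "no_capture \<rho> ?\<sigma> (ren \<rho>' ?\<sigma>' A) \<longleftrightarrow> no_capture (\<rho> \<circ> \<rho>') (?\<sigma> \<circ> ?\<sigma>') A"
    by (rule Quantifier.IH[OF body])
  also have "\<dots> \<longleftrightarrow> no_capture (\<rho> \<circ> \<rho>') ((\<sigma> \<circ> \<sigma>')(x := (\<rho> \<circ> \<rho>') x)) A"
    by (rule no_capture_cong) (simp add: apart)
  moreover have "(\<forall>z\<in>FV (ren \<rho>' ?\<sigma>' A) - {\<rho>' x}. \<sigma> z \<noteq> \<rho> (\<rho>' x)) \<longleftrightarrow>
      (\<forall>z\<in>FV A - {x}. \<sigma> (\<sigma>' z) \<noteq> \<rho> (\<rho>' x))"
    unfolding FV_ren[OF body] using apart by (auto split: if_splits)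
  ultimately show ?case using Quantifier.hyps by (auto simp: comp_def)
next
  case (Modality M X A)
  let ?\<sigma> = "override_on \<rho> \<sigma> (\<sigma>' ` fset X)" and ?\<sigma>' = "override_on \<rho>' \<sigma>' (fset X)"
  have body: "no_capture \<rho>' ?\<sigma>' A"
    and apart: "\<And>z y. z |\<in>| X \<Longrightarrow> y \<in> FV A \<Longrightarrow> y |\<notin>| X \<Longrightarrow> \<rho>' y \<noteq> \<sigma>' z"
    using Modality.hyps Modality.prems by auto
  have "no_capture \<rho> ?\<sigma> (ren \<rho>' ?\<sigma>' A) \<longleftrightarrow> no_capture (\<rho> \<circ> \<rho>') (?\<sigma> \<circ> ?\<sigma>') A"
    by (rule Modality.IH[OF body])
  also have "\<dots> \<longleftrightarrow> no_capture (\<rho> \<circ> \<rho>') (override_on (\<rho> \<circ> \<rho>') (\<sigma> \<circ> \<sigma>') (fset X)) A"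
    using apart by (intro no_capture_cong) (auto simp: override_on_def)
  moreover have "FV (ren \<rho>' ?\<sigma>' A) - \<sigma>' ` fset X = \<rho>' ` (FV A - fset X)"
    unfolding FV_ren[OF body] using apart by (auto simp: override_on_def)
  ultimately show ?case using Modality.hyps by (elim insertE rangeE) (simp_all add: comp_def)
qed auto

lemma ren_subst: "free_for \<sigma> A \<Longrightarrow> ren \<rho> \<tau> (subst \<sigma> A) = ren \<rho> (\<tau> \<circ> \<sigma>) A"
  unfolding subst_eq_ren free_for_iff_no_capture by (simp only: ren_ren comp_id)

lemma ren_subst_commute:
  assumes "inj \<rho>" and "free_for \<sigma> A" and "\<tau> \<circ> \<rho> = \<rho> \<circ> \<sigma>"
  shows "ren \<rho> \<rho> (subst \<sigma> A) = subst \<tau> (ren \<rho> \<rho> A)" and "free_for \<tau> (ren \<rho> \<rho> A)"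
proof -
  have no_capture: "no_capture id \<sigma> A" using assms(2) by (simp add: free_for_iff_no_capture)
  note inj = no_capture_inj[OF assms(1)]
  have "ren \<rho> \<rho> (subst \<sigma> A) = ren \<rho> (\<rho> \<circ> \<sigma>) A" by (rule ren_subst[OF assms(2)])
  also have "\<dots> = subst \<tau> (ren \<rho> \<rho> A)"
    by (simp only: subst_eq_ren ren_ren[OF inj] assms(3) id_comp)
  finally show "ren \<rho> \<rho> (subst \<sigma> A) = subst \<tau> (ren \<rho> \<rho> A)" .
  have "no_capture \<rho> (\<rho> \<circ> \<sigma>) A"
    using no_capture_ren[OF no_capture, of \<rho> \<rho>] inj by (simp only: comp_id)
  then show "free_for \<tau> (ren \<rho> \<rho> A)"
    by (simp only: free_for_iff_no_capture no_capture_ren[OF inj] assms(3) id_comp)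
qed

lemma ren_subst_var:
  assumes "inj \<rho>" and "free_for (id(x := y)) A"
  shows "ren \<rho> \<rho> (subst (id(x := y)) A) = subst (id(\<rho> x := \<rho> y)) (ren \<rho> \<rho> A)"
    and "free_for (id(\<rho> x := \<rho> y)) (ren \<rho> \<rho> A)"
proof -
  have "id(\<rho> x := \<rho> y) \<circ> \<rho> = \<rho> \<circ> id(x := y)"
    using assms(1) by (auto simp: fun_eq_iff inj_eq)
  then show "ren \<rho> \<rho> (subst (id(x := y)) A) = subst (id(\<rho> x := \<rho> y)) (ren \<rho> \<rho> A)"
    and "free_for (id(\<rho> x := \<rho> y)) (ren \<rho> \<rho> A)"
    by (rule ren_subst_commute[OF assms])+
qed

section \<open>Renaming of derivations\<close>

lemma beval_ren: "beval b (ren \<rho> \<sigma> A) = beval (\<lambda>B. b (ren \<rho> \<sigma> B)) A"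
  by (induction A) simp_all

lemma tautology_ren: "tautology A \<Longrightarrow> tautology (ren \<rho> \<sigma> A)"
  by (simp add: tautology_def beval_ren)

lemma fo_axiom_ren:
  assumes "inj \<rho>" and "fo_axiom A"
  shows "fo_axiom (ren \<rho> \<rho> A)"
  using assms(2)
proof cases
  case Taut
  then show ?thesis by (simp add: fo_axiom.Taut tautology_ren)
next
  case (All_inst x y B)
  then show ?thesis using ren_subst_var[OF assms(1)] by (simp add: fo_axiom.All_inst)
next
  case (Ex_intro x y B)
  then show ?thesis using ren_subst_var[OF assms(1)] by (simp add: fo_axiom.Ex_intro)
next
  case (All_dist x B C)
  then have "\<rho> x \<notin> FV (ren \<rho> \<rho> B)" by (simp add: FV_ren_inj inj_image_mem_iff assms(1))
  then show ?thesis using All_dist by (simp add: fo_axiom.All_dist)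
next
  case (Ex_dist x C B)
  then have "\<rho> x \<notin> FV (ren \<rho> \<rho> C)" by (simp add: FV_ren_inj inj_image_mem_iff assms(1))
  then show ?thesis using Ex_dist by (simp add: fo_axiom.Ex_dist)
qed

lemma folp_axiom_ren:
  assumes "inj \<rho>" and "folp_axiom A"
  shows "folp_axiom (ren \<rho> \<rho> A)"
  using assms(2)
proof cases
  case A0
  then show ?thesis using fo_axiom_ren[OF assms(1)] folp_axiom.A0 by blast
next
  case (A1 y B t X)
  then have "\<rho> y \<notin> FV (ren \<rho> \<rho> B)" by (simp add: FV_ren_inj inj_image_mem_iff assms(1))
  then show ?thesis using A1 by (simp add: folp_axiom.A1)
next
  case (A1' y B X)
  then have "\<rho> y \<notin> FV (ren \<rho> \<rho> B)" by (simp add: FV_ren_inj inj_image_mem_iff assms(1))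
  then show ?thesis using A1' by (simp add: folp_axiom.A1')
next
  case (A7 x X t B)
  then have "\<rho> x |\<notin>| \<rho> |`| X" by (simp add: inj_image_mem_iff assms(1))
  then show ?thesis using A7 by (simp add: folp_axiom.A7)
next
  case (A7' x X B)
  then have "\<rho> x |\<notin>| \<rho> |`| X" by (simp add: inj_image_mem_iff assms(1))
  then show ?thesis using A7' by (simp add: folp_axiom.A7')
qed (simp_all add: folp_axiom.intros)

lemma derives_ren:
  assumes "inj \<rho>" and "derives CS \<Gamma> A"
  shows "derives (ren \<rho> \<rho> ` CS) (ren \<rho> \<rho> ` \<Gamma>) (ren \<rho> \<rho> A)"
  using assms(2)
proof induction
  case (MP A B)
  then show ?case by (auto intro: derives.MP)
next
  case (Generalization A x)
  then show ?case
    by (auto intro!: derives.Generalization simp: FV_ren_inj inj_image_mem_iff assms(1))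
next
  case (Necessitation A)
  then show ?case using derives.Necessitation[OF folp_axiom_ren[OF assms(1)]] by simp
qed (auto intro: derives.Hyp derives.Axiom derives.ConstSpec folp_axiom_ren[OF assms(1)])

lemma derives_mono_const_spec: "derives CS \<Gamma> A \<Longrightarrow> CS \<subseteq> CS' \<Longrightarrow> derives CS' \<Gamma> A"
  by (induction rule: derives.induct) (auto intro: derives.intros)

lemma derives_finite_const_spec:
  "derives CS \<Gamma> A \<Longrightarrow> \<exists>C. finite C \<and> C \<subseteq> CS \<and> derives C \<Gamma> A"
proof (induction rule: derives.induct)
  case (ConstSpec A)
  then show ?case by (intro exI[of _ "{A}"]) (simp add: derives.ConstSpec)
next
  case (MP A B)
  then obtain C D where "finite C" "C \<subseteq> CS" "derives C \<Gamma> (Imp A B)"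
    and "finite D" "D \<subseteq> CS" "derives D \<Gamma> A" by blast
  then show ?case
    by (intro exI[of _ "C \<union> D"]) (auto intro: derives.MP derives_mono_const_spec)
qed (auto intro: derives.intros)

lemma inj_left_inverse_on_finite:
  fixes \<rho> :: "'a \<Rightarrow> 'b :: countable"
  assumes "inj \<rho>" and "finite F" and "infinite (UNIV :: 'a set)"
  obtains \<tau> where "inj \<tau>" and "\<And>x. x \<in> F \<Longrightarrow> \<tau> (\<rho> x) = x"
proof -
  obtain e :: "nat \<Rightarrow> 'a" where e: "inj e" "range e \<subseteq> - F"
    using infinite_countable_subset[of "- F"] assms(2,3) by (auto simp: finite_compl)
  define \<tau> where "\<tau> y = (if y \<in> \<rho> ` F then inv \<rho> y else e (to_nat y))" for y
  show thesis
  proof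
    show "inj \<tau>"
      using e assms(1) by (fastforce simp: \<tau>_def inj_def)
    show "\<tau> (\<rho> x) = x" if "x \<in> F" for x
      using that assms(1) by (simp add: \<tau>_def)
  qed
qed

lemma derives_ren_iff:
  assumes "inj \<rho>"
  shows "derives (ren \<rho> \<rho> ` CS) {} (ren \<rho> \<rho> A) \<longleftrightarrow> derives CS {} A"
proof
  assume "derives (ren \<rho> \<rho> ` CS) {} (ren \<rho> \<rho> A)"
  from derives_finite_const_spec[OF this]
  obtain D where D: "finite D" "D \<subseteq> ren \<rho> \<rho> ` CS" "derives D {} (ren \<rho> \<rho> A)" by blast
  obtain C where C: "finite C" "C \<subseteq> CS" "D = ren \<rho> \<rho> ` C"
    using finite_subset_image[OF D(1,2)] by blast
  have "finite (\<Union>B\<in>insert A C. vars B)" using C(1) by (simp add: finite_vars)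
  from inj_left_inverse_on_finite[OF assms this infinite_UNIV_nat]
  obtain \<tau> where \<tau>: "inj \<tau>" "\<And>x. x \<in> (\<Union>B\<in>insert A C. vars B) \<Longrightarrow> \<tau> (\<rho> x) = x" by blast
  have inverse: "ren \<tau> \<tau> (ren \<rho> \<rho> B) = B" if "B \<in> insert A C" for B
    unfolding ren_ren[OF no_capture_inj[OF assms]] using that \<tau>(2) FV_subset_vars[of B]
    by (intro ren_ident) auto
  have "ren \<tau> \<tau> ` ren \<rho> \<rho> ` C = C"
    unfolding image_image by (simp add: inverse cong: image_cong_simp)
  then have "derives C {} A"
    using derives_ren[OF \<tau>(1) D(3)[unfolded C(3)]] inverse[OF insertI1] by (simp only: image_empty)
  then show "derives CS {} A" using C(2) by (rule derives_mono_const_spec)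
next
  assume "derives CS {} A"
  then show "derives (ren \<rho> \<rho> ` CS) {} (ren \<rho> \<rho> A)"
    using derives_ren[OF assms, of CS "{}" A] by (simp only: image_empty)
qed

lemma const_spec_ren:
  assumes "inj \<rho>" and "const_spec CS"
  shows "const_spec (ren \<rho> \<rho> ` CS)"
  using assms(2) folp_axiom_ren[OF assms(1)] unfolding const_spec_def by fastforce

section \<open>Propositional and quantifier reasoning\<close>

definition imps :: "fm list \<Rightarrow> fm \<Rightarrow> fm" where
  "imps L A = foldr Imp L A"

lemma imps_simps [simp]: "imps [] A = A" "imps (B # L) A = Imp B (imps L A)"
  by (simp_all add: imps_def)

lemma beval_imps: "beval b (imps L A) \<longleftrightarrow> ((\<forall>B\<in>set L. beval b B) \<longrightarrow> beval b A)"
  by (induction L) auto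

lemma ren_imps: "ren \<rho> \<sigma> (imps L A) = imps (map (ren \<rho> \<sigma>) L) (ren \<rho> \<sigma> A)"
  by (induction L) simp_all

definition entails :: "fm set \<Rightarrow> fm set \<Rightarrow> fm \<Rightarrow> bool" where
  "entails CS S A \<longleftrightarrow> (\<exists>L. set L \<subseteq> S \<and> derives CS {} (imps L A))"

lemma derives_weaken_closed:
  assumes "derives CS {} A" and "\<forall>B\<in>\<Gamma>. closed_fm B"
  shows "derives CS \<Gamma> A"
  using assms(1)
proof induction
  case (MP A B)
  then show ?case by (blast intro: derives.MP)
next
  case (Generalization A x)
  then show ?case using assms(2) by (intro derives.Generalization) (auto simp: closed_fm_def)
qed (auto intro: derives.intros)

lemma derives_if_entails:
  assumes "entails CS \<Gamma> A" and "\<forall>B\<in>\<Gamma>. closed_fm B"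
  shows "derives CS \<Gamma> A"
proof -
  have detach: "derives CS \<Gamma> (imps L A) \<Longrightarrow> set L \<subseteq> \<Gamma> \<Longrightarrow> derives CS \<Gamma> A" for L
    by (induction L) (auto dest: MP[OF _ Hyp])
  obtain L where "set L \<subseteq> \<Gamma>" "derives CS {} (imps L A)"
    using assms(1) unfolding entails_def by blast
  then show ?thesis using derives_weaken_closed[OF _ assms(2)] detach by blast
qed

lemma entails_renD:
  assumes "inj \<rho>" and "entails (ren \<rho> \<rho> ` CS) (ren \<rho> \<rho> ` S) (ren \<rho> \<rho> A)"
  shows "entails CS S A"
proof -
  obtain K where K: "set K \<subseteq> ren \<rho> \<rho> ` S" "derives (ren \<rho> \<rho> ` CS) {} (imps K (ren \<rho> \<rho> A))"
    using assms(2) unfolding entails_def by blast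
  from K(1) have "K \<in> lists (ren \<rho> \<rho> ` S)" by auto
  then obtain L where L: "K = map (ren \<rho> \<rho>) L" "set L \<subseteq> S"
    unfolding lists_image by auto
  have "derives CS {} (imps L A)"
    using K(2) unfolding L(1) ren_imps[symmetric] derives_ren_iff[OF assms(1)] .
  then show ?thesis using L(2) unfolding entails_def by blast
qed

definition falsum :: fm where
  "falsum = Conj (Atom 0 []) (Neg (Atom 0 []))"

lemma beval_falsum [simp]: "\<not> beval b falsum"
  by (simp add: falsum_def)

locale folp =
  fixes CS :: "fm set"
  assumes const_spec: "const_spec CS"
begin

abbreviation provable :: "fm \<Rightarrow> bool" (\<open>\<turnstile> _\<close> [51] 50) where
  "\<turnstile> A \<equiv> derives CS {} A"

abbreviation entailment :: "fm set \<Rightarrow> fm \<Rightarrow> bool" (infix \<open>\<tturnstile>\<close> 50) where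
  "S \<tturnstile> A \<equiv> entails CS S A"

lemma provable_fo_axiom: "fo_axiom A \<Longrightarrow> \<turnstile> A"
  by (simp add: A0 Axiom)

lemma provable_by_taut:
  assumes "\<forall>B\<in>set L. \<turnstile> B" and "\<And>b. \<forall>B\<in>set L. beval b B \<Longrightarrow> beval b A"
  shows "\<turnstile> A"
proof -
  have "tautology (imps L A)" using assms(2) by (auto simp: tautology_def beval_imps)
  then have "\<turnstile> imps L A" by (intro provable_fo_axiom Taut)
  then show ?thesis using assms(1) by (induction L) (auto intro: MP)
qed

lemma provable_imp_refl: "\<turnstile> Imp A A"
  by (rule provable_by_taut[of "[]"]) auto

lemma provable_imp_trans: "\<turnstile> Imp A B \<Longrightarrow> \<turnstile> Imp B C \<Longrightarrow> \<turnstile> Imp A C"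
  by (rule provable_by_taut[of "[Imp A B, Imp B C]"]) auto

lemma provable_gen: "\<turnstile> A \<Longrightarrow> \<turnstile> All x A"
  by (simp add: Generalization)

lemma provable_subst: "\<turnstile> A \<Longrightarrow> free_for (id(x := y)) A \<Longrightarrow> \<turnstile> subst (id(x := y)) A"
  using MP[OF provable_fo_axiom[OF All_inst] provable_gen] .

lemma provable_All_elim: "\<turnstile> Imp (All x A) A"
  using provable_fo_axiom[OF All_inst[OF free_for_self]] by (simp only: subst_self)

lemma provable_Ex_intro: "\<turnstile> Imp A (Ex x A)"
  using provable_fo_axiom[OF Ex_intro[OF free_for_self]] by (simp only: subst_self)

lemma provable_Ex_iff: "\<turnstile> Iff (Ex x A) (Neg (All x (Neg A)))"
proof -
  have "\<turnstile> Imp (Neg (Ex x A)) (Neg A)"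
    by (rule provable_by_taut[of "[Imp A (Ex x A)]"]) (auto simp: provable_Ex_intro)
  then have only_if: "\<turnstile> Imp (Neg (Ex x A)) (All x (Neg A))"
    by (intro MP[OF provable_fo_axiom[OF All_dist] provable_gen]) auto
  have "\<turnstile> Imp A (Neg (All x (Neg A)))"
    by (rule provable_by_taut[of "[Imp (All x (Neg A)) (Neg A)]"]) (auto simp: provable_All_elim)
  then have "\<turnstile> Imp (Ex x A) (Neg (All x (Neg A)))"
    by (intro MP[OF provable_fo_axiom[OF Ex_dist] provable_gen]) auto
  with only_if show ?thesis
    by (intro provable_by_taut[of "[Imp (Neg (Ex x A)) (All x (Neg A)),
        Imp (Ex x A) (Neg (All x (Neg A)))]"]) auto
qed

lemma provable_All_imps:
  "\<forall>B\<in>set L. x \<notin> FV B \<Longrightarrow> \<turnstile> Imp (All x (imps L A)) (imps L (All x A))"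
proof (induction L)
  case Nil
  then show ?case by (simp add: provable_imp_refl)
next
  case (Cons B L)
  then have "\<turnstile> Imp (All x (imps L A)) (imps L (All x A))" by simp
  moreover have "\<turnstile> Imp (All x (Imp B (imps L A))) (Imp B (All x (imps L A)))"
    using Cons.prems by (intro provable_fo_axiom All_dist) simp
  ultimately show ?case
    by (intro provable_by_taut[of "[Imp (All x (imps L A)) (imps L (All x A)),
        Imp (All x (Imp B (imps L A))) (Imp B (All x (imps L A)))]"]) auto
qed

lemma entails_hyp: "A \<in> S \<Longrightarrow> S \<tturnstile> A"
  unfolding entails_def by (rule exI[of _ "[A]"]) (simp add: provable_imp_refl)

lemma entails_provable: "\<turnstile> A \<Longrightarrow> S \<tturnstile> A"
  unfolding entails_def by (rule exI[of _ "[]"]) simp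

lemma entails_by_taut:
  assumes "\<forall>B\<in>set L. S \<tturnstile> B" and "\<And>b. \<forall>B\<in>set L. beval b B \<Longrightarrow> beval b A"
  shows "S \<tturnstile> A"
proof -
  obtain J where J: "\<forall>B\<in>set L. set (J B) \<subseteq> S \<and> \<turnstile> imps (J B) B"
    using assms(1) unfolding entails_def by metis
  define K where "K = concat (map J L)"
  have "\<turnstile> imps K B" if "B \<in> set L" for B
    by (rule provable_by_taut[of "[imps (J B) B]"]) (use J that in \<open>auto simp: beval_imps K_def\<close>)
  then have "\<turnstile> imps K A"
    by (intro provable_by_taut[of "map (imps K) L"]) (use assms(2) in \<open>auto simp: beval_imps\<close>)
  moreover have "set K \<subseteq> S" using J by (auto simp: K_def)
  ultimately show ?thesis unfolding entails_def by blast
qed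

lemma entails_insertD:
  assumes "insert A S \<tturnstile> B"
  shows "S \<tturnstile> Imp A B"
proof -
  obtain L where L: "set L \<subseteq> insert A S" "\<turnstile> imps L B"
    using assms unfolding entails_def by blast
  have "\<turnstile> imps (removeAll A L) (Imp A B)"
    by (rule provable_by_taut[of "[imps L B]"]) (use L(2) in \<open>auto simp: beval_imps\<close>)
  then show ?thesis
    using L(1) unfolding entails_def by (intro exI[of _ "removeAll A L"]) auto
qed

lemma entails_gen:
  assumes "S \<tturnstile> A" and "\<forall>B\<in>S. x \<notin> FV B"
  shows "S \<tturnstile> All x A"
proof -
  obtain L where L: "set L \<subseteq> S" "\<turnstile> imps L A" using assms(1) unfolding entails_def by blast
  then have "\<turnstile> imps L (All x A)"
    using assms(2) by (intro MP[OF provable_All_imps provable_gen]) auto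
  then show ?thesis using L(1) unfolding entails_def by blast
qed

lemma entails_Union_chain:
  fixes F :: "nat \<Rightarrow> fm set"
  assumes "mono F" and "(\<Union>n. F n) \<tturnstile> A"
  shows "\<exists>n. F n \<tturnstile> A"
proof -
  obtain L where L: "set L \<subseteq> (\<Union>n. F n)" "\<turnstile> imps L A"
    using assms(2) unfolding entails_def by blast
  have "subset.chain UNIV (range F)"
    unfolding subset_chain_def using monoD[OF assms(1)] nat_le_linear by blast
  then obtain n where "set L \<subseteq> F n"
    using finite_subset_Union_chain[OF finite_set L(1), of UNIV] by blast
  then show ?thesis using L(2) unfolding entails_def by blast
qed

section \<open>Modal reasoning\<close>

lemma provable_necessitation: "\<turnstile> A \<Longrightarrow> \<turnstile> Box {||} A"
proof (induction rule: derives.induct)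
  case (Axiom A)
  then show ?case by (rule Necessitation)
next
  case (ConstSpec A)
  then obtain c B where A: "A = Just (JConst c) {||} B"
    using const_spec unfolding const_spec_def by blast
  have "\<turnstile> Just (Bang (JConst c)) {||} A"
    unfolding A by (rule MP[OF Axiom[OF A6]]) (use ConstSpec A derives.ConstSpec in blast)
  then show ?case by (rule MP[OF Axiom[OF A8]])
next
  case (MP A B)
  show ?case by (rule derives.MP[OF derives.MP[OF Axiom[OF A4'] MP.IH(1)] MP.IH(2)])
next
  case (Generalization A x)
  show ?case by (rule derives.MP[OF Axiom[OF A7'] Generalization.IH]) simp
next
  case (Necessitation A)
  show ?case
    by (rule derives.MP[OF Axiom[OF A6']]) (rule derives.Necessitation[OF Necessitation])
qed simp

lemma provable_Box_extend: "\<turnstile> Imp (Box Y A) (Box (Y |\<union>| Z) A)"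
proof (induction Z)
  case empty
  then show ?case by (simp add: provable_imp_refl)
next
  case (insert z Z)
  then show ?case
    using provable_imp_trans[OF _ Axiom[OF A2'], of "Box Y A" "Y |\<union>| Z" A z] by simp
qed

lemma provable_imp_drop_indices:
  assumes "\<And>z Y. z |\<in>| Z \<Longrightarrow> \<turnstile> Imp (M (finsert z Y)) (M Y)"
  shows "\<turnstile> Imp (M (Y |\<union>| Z)) (M Y)"
  using assms
proof (induction Z)
  case empty
  then show ?case by (simp add: provable_imp_refl)
next
  case (insert z Z)
  then have "\<turnstile> Imp (M (finsert z (Y |\<union>| Z))) (M (Y |\<union>| Z))" "\<turnstile> Imp (M (Y |\<union>| Z)) (M Y)"
    by auto
  then have "\<turnstile> Imp (M (finsert z (Y |\<union>| Z))) (M Y)" by (rule provable_imp_trans)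
  then show ?case by simp
qed

lemma provable_Box_restrict:
  "fset Z \<inter> FV A = {} \<Longrightarrow> \<turnstile> Imp (Box (Y |\<union>| Z) A) (Box Y A)"
  by (rule provable_imp_drop_indices[of Z "\<lambda>X. Box X A"]) (auto intro: Axiom A1')

lemma provable_Just_restrict:
  "fset Z \<inter> FV A = {} \<Longrightarrow> \<turnstile> Imp (Just t (Y |\<union>| Z) A) (Just t Y A)"
  by (rule provable_imp_drop_indices[of Z "\<lambda>X. Just t X A"]) (auto intro: Axiom A1)

end

section \<open>Saturated sets\<close>

instance jterm :: countable
  by countable_datatype

instance fm :: countable
  by countable_datatype

definition params :: "fm set \<Rightarrow> var set" where
  "params w = (\<Union>A\<in>w. FV A)"

lemma FV_subset_params: "A \<in> w \<Longrightarrow> FV A \<subseteq> params w"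
  unfolding params_def by blast

lemma params_insert [simp]: "params (insert A S) = FV A \<union> params S"
  by (simp add: params_def)

definition decides :: "var set \<Rightarrow> fm set \<Rightarrow> fm \<Rightarrow> bool" where
  "decides P S A \<longleftrightarrow> A \<in> S \<or> (Neg A \<in> S \<and>
     (\<forall>x B. A = All x B \<longrightarrow>
        (\<exists>v\<in>P. free_for (id(x := v)) B \<and> Neg (subst (id(x := v)) B) \<in> S)))"

lemma decides_mono: "decides P S A \<Longrightarrow> S \<subseteq> T \<Longrightarrow> decides P T A"
  unfolding decides_def by blast

context folp
begin

definition consistent :: "fm set \<Rightarrow> bool" where
  "consistent S \<longleftrightarrow> \<not> S \<tturnstile> falsum"

lemma consistent_Neg: "consistent S \<Longrightarrow> S \<tturnstile> A \<Longrightarrow> \<not> S \<tturnstile> Neg A"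
  unfolding consistent_def using entails_by_taut[of "[A, Neg A]" S falsum] by auto

lemma not_consistent_insert: "\<not> consistent (insert A S) \<Longrightarrow> S \<tturnstile> Neg A"
  unfolding consistent_def
  by (rule entails_by_taut[of "[Imp A falsum]"]) (auto dest: entails_insertD)

lemma not_consistent_insert_Neg: "\<not> consistent (insert (Neg A) S) \<Longrightarrow> S \<tturnstile> A"
  by (rule entails_by_taut[of "[Neg (Neg A)]"]) (auto dest: not_consistent_insert)

lemma consistent_Union_chain:
  fixes F :: "nat \<Rightarrow> fm set"
  shows "mono F \<Longrightarrow> (\<And>n. consistent (F n)) \<Longrightarrow> consistent (\<Union>n. F n)"
  using entails_Union_chain unfolding consistent_def by blast

lemma provable_All_rename:
  assumes "v \<notin> vars (All x A)"
  shows "\<turnstile> Imp (All v (subst (id(x := v)) A)) (All x A)"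
proof -
  let ?A = "subst (id(x := v)) A"
  have v: "v \<notin> vars A" "v \<noteq> x" using assms by auto
  have free: "free_for (id(x := v)) A" by (rule free_for_fresh[OF v(1)])
  then have no_capture: "no_capture id (id(x := v)) A" by (simp add: free_for_iff_no_capture)
  have inverse: "(id(v := x) \<circ> id(x := v)) z = z" if "z \<in> FV A" for z
    using that v(1) FV_subset_vars[of A] by auto
  have "no_capture id (id(v := x) \<circ> id(x := v)) A"
    by (rule no_captureI) (simp_all only: inverse inj_on_id id_apply not_False_eq_True)
  then have "free_for (id(v := x)) ?A"
    by (simp only: free_for_iff_no_capture subst_eq_ren no_capture_ren[OF no_capture] comp_id)
  moreover have "subst (id(v := x)) ?A = A"
    unfolding subst_eq_ren ren_ren[OF no_capture]
    by (rule ren_ident) (simp_all only: inverse comp_id id_apply)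
  ultimately have "\<turnstile> Imp (All v ?A) A"
    using provable_fo_axiom[OF All_inst, of v x ?A] by simp
  moreover have "x \<notin> FV (All v ?A)"
    using v by (auto simp: FV_subst[OF free])
  ultimately show ?thesis
    by (intro MP[OF provable_fo_axiom[OF All_dist] provable_gen])
qed

lemma consistent_insert_Neg_instance:
  assumes "consistent S" and mem: "Neg (All x A) \<in> S" and "v \<notin> params S" and v: "v \<notin> vars A" "v \<noteq> x"
  shows "consistent (insert (Neg (subst (id(x := v)) A)) S)"
proof (rule ccontr)
  let ?A = "subst (id(x := v)) A"
  assume "\<not> consistent (insert (Neg ?A) S)"
  then have "S \<tturnstile> ?A" by (rule not_consistent_insert_Neg)
  then have "S \<tturnstile> All v ?A"
    by (rule entails_gen) (use assms(3) in \<open>auto simp: params_def\<close>)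
  moreover have "S \<tturnstile> Imp (All v ?A) (All x A)"
    using v by (intro entails_provable provable_All_rename) simp
  ultimately have "S \<tturnstile> All x A"
    by (intro entails_by_taut[of "[All v ?A, Imp (All v ?A) (All x A)]"]) auto
  then show False using consistent_Neg[OF assms(1)] entails_hyp[OF mem] by blast
qed

definition extensible :: "var set \<Rightarrow> fm set \<Rightarrow> bool" where
  "extensible P S \<longleftrightarrow> consistent S \<and> params S \<subseteq> P \<and> infinite (P - params S)"

lemma extensible_insert:
  assumes "extensible P S" and "consistent (insert A S)" and "FV A \<subseteq> P"
  shows "extensible P (insert A S)"
proof -
  have "P - params (insert A S) = (P - params S) - FV A" by auto
  then have "infinite (P - params (insert A S))"
    using assms(1) finite_FV by (simp only: extensible_def Diff_infinite_finite not_False_eq_True)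
  then show ?thesis using assms by (simp add: extensible_def)
qed

lemma ex_extensible_Neg_instance:
  assumes "extensible P S" and mem: "Neg (All x A) \<in> S"
  shows "\<exists>v\<in>P. free_for (id(x := v)) A \<and> extensible P (insert (Neg (subst (id(x := v)) A)) S)"
proof -
  have "infinite (P - params S - vars (All x A))"
    using assms(1) finite_vars by (simp only: extensible_def Diff_infinite_finite not_False_eq_True)
  then obtain v where "v \<in> P - params S - vars (All x A)"
    using infinite_imp_nonempty by blast
  then have v: "v \<in> P" "v \<notin> params S" "v \<notin> vars A" "v \<noteq> x" by auto
  have free: "free_for (id(x := v)) A" by (rule free_for_fresh[OF v(3)])
  have "consistent (insert (Neg (subst (id(x := v)) A)) S)"
    using assms(1) unfolding extensible_def
    by (intro consistent_insert_Neg_instance[OF _ mem v(2-4)]) blast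
  moreover have "FV (Neg (subst (id(x := v)) A)) \<subseteq> P"
    using FV_subset_params[OF mem] assms(1) v(1) by (auto simp: FV_subst[OF free] extensible_def)
  ultimately have "extensible P (insert (Neg (subst (id(x := v)) A)) S)"
    by (rule extensible_insert[OF assms(1)])
  then show ?thesis using v(1) free by blast
qed

lemma ex_deciding_extension:
  assumes "extensible P S" and "FV A \<subseteq> P"
  shows "\<exists>T. S \<subseteq> T \<and> extensible P T \<and> decides P T A"
proof (cases "consistent (insert A S)")
  case True
  then have "extensible P (insert A S)" by (rule extensible_insert[OF assms(1) _ assms(2)])
  then show ?thesis by (intro exI[of _ "insert A S"]) (auto simp: decides_def)
next
  case False
  let ?S = "insert (Neg A) S"
  have "consistent ?S"
    using assms(1) not_consistent_insert[OF False] not_consistent_insert_Neg consistent_Neg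
    unfolding extensible_def by blast
  then have extensible: "extensible P ?S"
    by (rule extensible_insert[OF assms(1)]) (simp add: assms(2))
  show ?thesis
  proof (cases "\<exists>x B. A = All x B")
    case False
    then show ?thesis using extensible by (intro exI[of _ ?S]) (auto simp: decides_def)
  next
    case True
    then obtain x B where A: "A = All x B" by blast
    then obtain v where "v \<in> P" "free_for (id(x := v)) B"
      and "extensible P (insert (Neg (subst (id(x := v)) B)) ?S)"
      using ex_extensible_Neg_instance[OF extensible] by blast
    then show ?thesis
      using A by (intro exI[of _ "insert (Neg (subst (id(x := v)) B)) ?S"]) (auto simp: decides_def)
  qed
qed

lemma ex_deciding_chain:
  assumes "extensible P S"
  shows "\<exists>F :: nat \<Rightarrow> fm set. mono F \<and> (\<forall>n. S \<subseteq> F n \<and> extensible P (F n)) \<and>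
    (\<forall>A. FV A \<subseteq> P \<longrightarrow> (\<exists>n. decides P (F n) A))"
proof -
  let ?step = "\<lambda>n T T'. T \<subseteq> T' \<and> (FV (from_nat n) \<subseteq> P \<longrightarrow> decides P T' (from_nat n))"
  have "\<exists>F. \<forall>n. (S \<subseteq> F n \<and> extensible P (F n)) \<and> ?step n (F n) (F (Suc n))"
  proof (rule dependent_nat_choice)
    show "\<exists>T. S \<subseteq> T \<and> extensible P T" using assms by blast
  next
    fix T n assume "S \<subseteq> T \<and> extensible P T"
    then show "\<exists>T'. (S \<subseteq> T' \<and> extensible P T') \<and> ?step n T T'"
      using ex_deciding_extension[of P T "from_nat n"] by (meson order_refl subset_trans)
  qed
  then obtain F where F: "\<forall>n. S \<subseteq> F n \<and> extensible P (F n)"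
    and step: "\<And>n. ?step n (F n) (F (Suc n))" by blast
  have "mono F" using step by (simp add: mono_iff_le_Suc)
  moreover have "decides P (F (Suc (to_nat A))) A" if "FV A \<subseteq> P" for A
    using step[of "to_nat A"] that by simp
  ultimately show ?thesis using F by blast
qed

definition saturated :: "fm set \<Rightarrow> bool" where
  "saturated w \<longleftrightarrow> consistent w \<and> params w \<noteq> {} \<and>
     (\<forall>A. FV A \<subseteq> params w \<longrightarrow> decides (params w) w A)"

lemma lindenbaum:
  assumes "extensible P S"
  shows "\<exists>w. saturated w \<and> params w = P \<and> S \<subseteq> w"
proof -
  from ex_deciding_chain[OF assms]
  obtain F :: "nat \<Rightarrow> fm set" where "mono F" and F: "\<forall>n. S \<subseteq> F n \<and> extensible P (F n)"
    and decides_F: "\<forall>A. FV A \<subseteq> P \<longrightarrow> (\<exists>n. decides P (F n) A)" by blast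
  define w where "w = (\<Union>n. F n)"
  have "consistent w"
    unfolding w_def
    by (rule consistent_Union_chain[OF \<open>mono F\<close>]) (use F in \<open>simp add: extensible_def\<close>)
  moreover have decides: "decides P w A" if "FV A \<subseteq> P" for A
    using decides_F that decides_mono[of P _ A w] unfolding w_def by blast
  moreover have "params w = P"
  proof
    show "params w \<subseteq> P" using F by (auto simp: w_def params_def extensible_def)
    show "P \<subseteq> params w"
    proof
      fix v assume "v \<in> P"
      then have "decides P w (Atom 0 [v])" by (intro decides) simp
      then show "v \<in> params w" unfolding decides_def params_def by force
    qed
  qed
  moreover have "P \<noteq> {}" using assms by (auto simp: extensible_def)
  moreover have "S \<subseteq> w" using F by (auto simp: w_def)
  ultimately show ?thesis unfolding saturated_def by blast
qed

lemma saturated_closed: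
  assumes "saturated w" and "w \<tturnstile> A" and "FV A \<subseteq> params w"
  shows "A \<in> w"
  using assms consistent_Neg[of w A] entails_hyp[of "Neg A" w]
  unfolding saturated_def decides_def by blast

lemma saturated_Neg_iff: "saturated w \<Longrightarrow> FV A \<subseteq> params w \<Longrightarrow> Neg A \<in> w \<longleftrightarrow> A \<notin> w"
  using consistent_Neg[of w A] entails_hyp unfolding saturated_def decides_def by blast

lemma saturated_by_taut:
  assumes "saturated w" and "set L \<subseteq> w" and "\<And>b. \<forall>B\<in>set L. beval b B \<Longrightarrow> beval b A"
    and "FV A \<subseteq> params w"
  shows "A \<in> w"
  by (rule saturated_closed[OF assms(1) entails_by_taut[OF _ assms(3)] assms(4)])
    (use assms(2) entails_hyp in blast)

lemma saturated_truth_functional: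
  assumes w: "saturated w" and FV: "FV A \<subseteq> params w" "FV B \<subseteq> params w" "FV C \<subseteq> params w"
    and C: "\<And>b. beval b C \<longleftrightarrow> h (beval b A) (beval b B)"
  shows "C \<in> w \<longleftrightarrow> h (A \<in> w) (B \<in> w)"
proof -
  define sign where "sign D = (if D \<in> w then D else Neg D)" for D
  have "sign A \<in> w" "sign B \<in> w"
    using saturated_Neg_iff[OF w] FV by (simp_all add: sign_def)
  then have determined: "D \<in> w"
    if "\<And>b. beval b (sign A) \<Longrightarrow> beval b (sign B) \<Longrightarrow> beval b D" "FV D \<subseteq> params w" for D
    using that by (intro saturated_by_taut[OF w, of "[sign A, sign B]"]) auto
  show ?thesis
  proof (cases "h (A \<in> w) (B \<in> w)")
    case True
    have "C \<in> w"
      by (rule determined[OF _ FV(3)]) (use True in \<open>auto simp: sign_def C split: if_splits\<close>)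
    then show ?thesis using True by simp
  next
    case False
    have "Neg C \<in> w"
      by (rule determined) (use False FV(3) in \<open>auto simp: sign_def C split: if_splits\<close>)
    then show ?thesis using False saturated_Neg_iff[OF w FV(3)] by simp
  qed
qed

lemma saturated_provable_imp:
  assumes "saturated w" and "\<turnstile> Imp A B" and "A \<in> w" and "FV B \<subseteq> params w"
  shows "B \<in> w"
  by (rule saturated_closed[OF assms(1) entails_by_taut[of "[Imp A B, A]"] assms(4)])
    (use assms(2,3) entails_provable entails_hyp in auto)

lemma saturated_MP: "saturated w \<Longrightarrow> Imp A B \<in> w \<Longrightarrow> A \<in> w \<Longrightarrow> B \<in> w"
  by (rule saturated_by_taut[of w "[Imp A B, A]"]) (use FV_subset_params[of "Imp A B" w] in auto)

lemma saturated_Box_extend: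
  "saturated w \<Longrightarrow> Box Y A \<in> w \<Longrightarrow> Y |\<subseteq>| Z \<Longrightarrow> fset Z \<subseteq> params w \<Longrightarrow> Box Z A \<in> w"
  using saturated_provable_imp[OF _ provable_Box_extend[of Y A Z], of w]
  by (simp only: sup.absorb2 FV.simps)

lemma saturated_Box_MP:
  assumes "saturated w" and "Box X (Imp A B) \<in> w" and "Box X A \<in> w"
  shows "Box X B \<in> w"
proof -
  have "Imp (Box X A) (Box X B) \<in> w"
    by (rule saturated_provable_imp[OF assms(1) Axiom[OF A4'] assms(2)])
      (use FV_subset_params[OF assms(3)] in auto)
  then show ?thesis using saturated_MP[OF assms(1)] assms(3) by blast
qed

lemma saturated_Box_provable:
  assumes "saturated w" and "\<turnstile> A" and "fset X \<subseteq> params w"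
  shows "Box X A \<in> w"
proof (rule saturated_Box_extend[OF assms(1) _ _ assms(3)])
  show "Box {||} A \<in> w"
    by (rule saturated_closed[OF assms(1) entails_provable[OF provable_necessitation[OF assms(2)]]])
      simp
qed simp

definition boxes :: "fm set \<Rightarrow> fm set" where
  "boxes w = {A \<in> w. \<exists>X B. A = Box X B}"

lemma saturated_Box_if_mem_boxes:
  assumes "saturated w" and "A \<in> boxes w" and "FV A \<subseteq> fset Y" and "fset Y \<subseteq> params w"
  shows "Box Y A \<in> w"
proof -
  obtain Z B where A: "A = Box Z B" using assms(2) unfolding boxes_def by blast
  have "Box Z A \<in> w"
    unfolding A by (rule saturated_provable_imp[OF assms(1) Axiom[OF A6']])
      (use assms A in \<open>auto simp: boxes_def\<close>)
  then show ?thesis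
    by (rule saturated_Box_extend[OF assms(1) _ _ assms(4)])
      (use assms(3) A in \<open>simp add: less_eq_fset.rep_eq\<close>)
qed

lemma saturated_Box_if_boxes_entail:
  assumes w: "saturated w" and Z: "fset Z \<subseteq> params w" and D: "FV D \<subseteq> fset Z" and "boxes w \<tturnstile> D"
  shows "Box Z D \<in> w"
proof -
  obtain L where L: "set L \<subseteq> boxes w" "\<turnstile> imps L D"
    using assms(4) unfolding entails_def by blast
  have "finite (fset Z \<union> params (set L))" by (simp add: finite_FV params_def)
  then obtain Y where Y: "fset Y = fset Z \<union> params (set L)" by (rule obtain_fset)
  have Y_params: "fset Y \<subseteq> params w"
    unfolding Y using Z L(1) by (auto simp: params_def boxes_def)
  have "Box Y (imps K D) \<in> w \<Longrightarrow> set K \<subseteq> set L \<Longrightarrow> Box Y D \<in> w" for K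
  proof (induction K)
    case (Cons B K)
    have "Box Y B \<in> w"
      using Cons.prems(2) L(1) Y
      by (intro saturated_Box_if_mem_boxes[OF w _ _ Y_params]) (auto simp: params_def)
    then show ?case using Cons saturated_Box_MP[OF w] by auto
  qed simp
  then have "Box Y D \<in> w"
    using saturated_Box_provable[OF w L(2) Y_params] by blast
  moreover have "Z |\<union>| (Y |-| Z) = Y" using Y by (auto simp: fset_eq_iff)
  moreover have "fset (Y |-| Z) \<inter> FV D = {}" using D by auto
  ultimately show ?thesis
    using saturated_provable_imp[OF w provable_Box_restrict[of "Y |-| Z" D Z]] Z
    by (simp only: FV.simps)
qed

end

section \<open>Worlds\<close>

locale folp_embedding = folp +
  fixes \<rho> :: "var \<Rightarrow> var"
  assumes inj: "inj \<rho>" and coinfinite: "infinite (- range \<rho>)"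
begin

text \<open>Infinitely many variables outside the range of \<open>\<rho>\<close> are left unused, to serve as witnesses in
  accessible worlds.\<close>

definition world :: "fm set \<Rightarrow> bool" where
  "world w \<longleftrightarrow> saturated w \<and> params w \<inter> range \<rho> = {} \<and> infinite (- range \<rho> - params w)"

lemma world_saturated: "world w \<Longrightarrow> saturated w"
  by (simp add: world_def)

lemmas world_closed = saturated_closed[OF world_saturated]
lemmas world_provable_imp = saturated_provable_imp[OF world_saturated]
lemmas world_MP = saturated_MP[OF world_saturated]

lemma param_notin_range: "world w \<Longrightarrow> d \<in> params w \<Longrightarrow> d \<notin> range \<rho>"
  by (auto simp: world_def)

lemma world_params_nonempty: "world w \<Longrightarrow> params w \<noteq> {}"
  by (simp add: world_def saturated_def)

lemma ex_world:
  assumes "consistent S" and "params S \<subseteq> P" and "P \<inter> range \<rho> = {}"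
    and "infinite (- range \<rho> - P)"
  shows "\<exists>w. world w \<and> S \<subseteq> w \<and> P \<subseteq> params w"
proof -
  obtain U V where UV: "U \<subseteq> - range \<rho> - P" "V \<subseteq> - range \<rho> - P"
    "infinite U" "infinite V" "U \<inter> V = {}"
    using infinite_split[OF assms(4)] by blast
  have "U \<subseteq> P \<union> U - params S" using UV(1) assms(2) by blast
  then have "extensible (P \<union> U) S"
    using assms(1,2) UV(3) infinite_super unfolding extensible_def by blast
  then obtain w where w: "saturated w" "params w = P \<union> U" "S \<subseteq> w"
    using lindenbaum by blast
  have "V \<subseteq> - range \<rho> - params w" using UV(2,5) w(2) by blast
  then have "infinite (- range \<rho> - params w)" using UV(4) infinite_super by blast
  moreover have "params w \<inter> range \<rho> = {}" using UV(1) assms(3) w(2) by blast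
  ultimately show ?thesis using w unfolding world_def by blast
qed

lemma ex_world_omitting:
  assumes "\<not> S \<tturnstile> A" and "params S \<union> FV A \<subseteq> P" and "P \<inter> range \<rho> = {}"
    and "infinite (- range \<rho> - P)"
  shows "\<exists>w. world w \<and> S \<subseteq> w \<and> P \<subseteq> params w \<and> A \<notin> w"
proof -
  have "consistent (insert (Neg A) S)"
    using assms(1) not_consistent_insert_Neg by blast
  moreover have "params (insert (Neg A) S) \<subseteq> P" using assms(2) by simp
  ultimately obtain w where w: "world w" "insert (Neg A) S \<subseteq> w" "P \<subseteq> params w"
    using ex_world[OF _ _ assms(3,4)] by blast
  then have "A \<notin> w"
    using saturated_Neg_iff[OF world_saturated[OF w(1)], of A] assms(2) by blast
  then show ?thesis using w by blast
qed

abbreviation emb :: "(var \<Rightarrow> var) \<Rightarrow> fm \<Rightarrow> fm" where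
  "emb \<equiv> ren \<rho>"

definition admissible :: "(var \<Rightarrow> var) \<Rightarrow> bool" where
  "admissible \<sigma> \<longleftrightarrow> (\<forall>x. \<sigma> x = \<rho> x \<or> \<sigma> x \<notin> range \<rho>)"

lemma admissible_if_disjoint: "range \<sigma> \<inter> range \<rho> = {} \<Longrightarrow> admissible \<sigma>"
  unfolding admissible_def by blast

lemma admissible_neq: "admissible \<sigma> \<Longrightarrow> x \<noteq> y \<Longrightarrow> \<sigma> x \<noteq> \<rho> y"
  using inj unfolding admissible_def by (metis injD rangeI)

lemma admissible_upd: "admissible \<sigma> \<Longrightarrow> d = \<rho> y \<or> d \<notin> range \<rho> \<Longrightarrow> admissible (\<sigma>(y := d))"
  by (auto simp: admissible_def)

lemma admissible_upd_param: "admissible \<sigma> \<Longrightarrow> world w \<Longrightarrow> d \<in> params w \<Longrightarrow> admissible (\<sigma>(y := d))"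
  using admissible_upd param_notin_range by blast

lemma admissible_override: "admissible \<sigma> \<Longrightarrow> admissible (override_on \<rho> \<sigma> S)"
  by (simp add: admissible_def override_on_def)

lemma no_capture_admissible: "admissible \<sigma> \<Longrightarrow> no_capture \<rho> \<sigma> A"
  using inj_on_subset[OF inj] admissible_neq by (intro no_captureI) auto

lemma FV_emb: "admissible \<sigma> \<Longrightarrow> FV (emb \<sigma> A) = \<sigma> ` FV A"
  by (rule FV_ren[OF no_capture_admissible])

lemma emb_mem_params: "admissible \<sigma> \<Longrightarrow> emb \<sigma> A \<in> w \<Longrightarrow> \<sigma> ` FV A \<subseteq> params w"
  using FV_subset_params FV_emb by blast

lemma emb_instance:
  assumes "admissible \<sigma>" and "d \<notin> range \<rho>"
  shows "free_for (id(\<rho> y := d)) (emb (\<sigma>(y := \<rho> y)) A)"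
    and "subst (id(\<rho> y := d)) (emb (\<sigma>(y := \<rho> y)) A) = emb (\<sigma>(y := d)) A"
proof -
  have no_capture: "no_capture \<rho> (\<sigma>(y := \<rho> y)) A"
    using assms(1) by (intro no_capture_admissible admissible_upd) simp_all
  have comp: "id(\<rho> y := d) \<circ> \<sigma>(y := \<rho> y) = \<sigma>(y := d)"
    using admissible_neq[OF assms(1), of _ y] by (auto simp: fun_eq_iff)
  have "no_capture \<rho> (\<sigma>(y := d)) A"
    using assms by (intro no_capture_admissible admissible_upd) simp_all
  then show "free_for (id(\<rho> y := d)) (emb (\<sigma>(y := \<rho> y)) A)"
    by (simp only: free_for_iff_no_capture no_capture_ren[OF no_capture] comp id_comp)
  show "subst (id(\<rho> y := d)) (emb (\<sigma>(y := \<rho> y)) A) = emb (\<sigma>(y := d)) A"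
    by (simp only: subst_eq_ren ren_ren[OF no_capture] comp id_comp)
qed

lemma world_truth_functional:
  assumes w: "world w" and \<sigma>: "admissible \<sigma>" and FV: "FV C = \<sigma> ` (FV A \<union> FV B)"
    and C: "\<And>b. beval b C \<longleftrightarrow> h (beval b (emb \<sigma> A)) (beval b (emb \<sigma> B))"
  shows "C \<in> w \<longleftrightarrow> \<sigma> ` (FV A \<union> FV B) \<subseteq> params w \<and> h (emb \<sigma> A \<in> w) (emb \<sigma> B \<in> w)"
proof (cases "\<sigma> ` (FV A \<union> FV B) \<subseteq> params w")
  case True
  then have "C \<in> w \<longleftrightarrow> h (emb \<sigma> A \<in> w) (emb \<sigma> B \<in> w)"
    by (intro saturated_truth_functional[OF world_saturated[OF w]] C)
      (auto simp: FV_emb[OF \<sigma>] FV)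
  then show ?thesis using True by simp
next
  case False
  then show ?thesis using FV_subset_params[of C w] FV by auto
qed

lemma world_Neg:
  assumes "world w" and "admissible \<sigma>"
  shows "Neg (emb \<sigma> A) \<in> w \<longleftrightarrow> \<sigma> ` FV A \<subseteq> params w \<and> emb \<sigma> A \<notin> w"
  using world_truth_functional[OF assms, of _ A A "\<lambda>a b. \<not> a"] by (simp add: FV_emb assms(2))

lemma world_Conj:
  assumes "world w" and "admissible \<sigma>"
  shows "Conj (emb \<sigma> A) (emb \<sigma> B) \<in> w \<longleftrightarrow> emb \<sigma> A \<in> w \<and> emb \<sigma> B \<in> w"
proof -
  have "Conj (emb \<sigma> A) (emb \<sigma> B) \<in> w \<longleftrightarrow>
      \<sigma> ` (FV A \<union> FV B) \<subseteq> params w \<and> emb \<sigma> A \<in> w \<and> emb \<sigma> B \<in> w"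
    by (rule world_truth_functional[OF assms]) (simp_all add: FV_emb assms(2) image_Un)
  then show ?thesis using emb_mem_params[OF assms(2)] unfolding image_Un by blast
qed

lemma world_Disj:
  assumes "world w" and "admissible \<sigma>"
  shows "Disj (emb \<sigma> A) (emb \<sigma> B) \<in> w \<longleftrightarrow>
    \<sigma> ` (FV A \<union> FV B) \<subseteq> params w \<and> (emb \<sigma> A \<in> w \<or> emb \<sigma> B \<in> w)"
  by (rule world_truth_functional[OF assms]) (simp_all add: FV_emb assms(2) image_Un)

lemma world_Imp:
  assumes "world w" and "admissible \<sigma>"
  shows "Imp (emb \<sigma> A) (emb \<sigma> B) \<in> w \<longleftrightarrow>
    \<sigma> ` (FV A \<union> FV B) \<subseteq> params w \<and> (emb \<sigma> A \<in> w \<longrightarrow> emb \<sigma> B \<in> w)"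
  by (rule world_truth_functional[OF assms]) (simp_all add: FV_emb assms(2) image_Un)

lemma world_Iff:
  assumes "world w" and "admissible \<sigma>"
  shows "Iff (emb \<sigma> A) (emb \<sigma> B) \<in> w \<longleftrightarrow>
    \<sigma> ` (FV A \<union> FV B) \<subseteq> params w \<and> (emb \<sigma> A \<in> w \<longleftrightarrow> emb \<sigma> B \<in> w)"
  by (rule world_truth_functional[OF assms]) (simp_all add: FV_emb assms(2) image_Un)

lemma world_All_elim:
  assumes w: "world w" and \<sigma>: "admissible \<sigma>" and mem: "emb \<sigma> (All y A) \<in> w" and d: "d \<in> params w"
  shows "emb (\<sigma>(y := d)) A \<in> w"
proof -
  note instance_d = emb_instance[OF \<sigma> param_notin_range[OF w d], of y A]
  have "\<turnstile> Imp (emb \<sigma> (All y A)) (emb (\<sigma>(y := d)) A)"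
    using provable_fo_axiom[OF All_inst[OF instance_d(1)]] by (simp only: instance_d(2) ren.simps)
  moreover have "FV (emb (\<sigma>(y := d)) A) \<subseteq> params w"
    using emb_mem_params[OF \<sigma> mem] d by (auto simp: FV_emb[OF admissible_upd_param[OF \<sigma> w d]])
  ultimately show ?thesis using world_provable_imp[OF w] mem by blast
qed

lemma world_All_intro:
  assumes w: "world w" and \<sigma>: "admissible \<sigma>" and all: "\<And>d. d \<in> params w \<Longrightarrow> emb (\<sigma>(y := d)) A \<in> w"
  shows "emb \<sigma> (All y A) \<in> w"
proof (rule ccontr)
  obtain d where d: "d \<in> params w" using world_params_nonempty[OF w] by blast
  have "(\<sigma>(y := d)) ` FV A \<subseteq> params w"
    by (rule emb_mem_params[OF admissible_upd_param[OF \<sigma> w d] all[OF d]])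
  then have "FV (emb \<sigma> (All y A)) \<subseteq> params w"
    unfolding FV_emb[OF \<sigma>] by auto
  then have "decides (params w) w (emb \<sigma> (All y A))"
    using world_saturated[OF w] unfolding saturated_def by blast
  moreover assume "emb \<sigma> (All y A) \<notin> w"
  ultimately obtain v where v: "v \<in> params w"
    "Neg (subst (id(\<rho> y := v)) (emb (\<sigma>(y := \<rho> y)) A)) \<in> w"
    unfolding decides_def ren.simps by blast
  then have "Neg (emb (\<sigma>(y := v)) A) \<in> w"
    by (simp only: emb_instance(2)[OF \<sigma> param_notin_range[OF w v(1)]])
  then show False
    using all[OF v(1)] world_Neg[OF w admissible_upd_param[OF \<sigma> w v(1)]] by blast
qed

lemma world_All:
  assumes "world w" and "admissible \<sigma>"
  shows "emb \<sigma> (All y A) \<in> w \<longleftrightarrow> (\<forall>d\<in>params w. emb (\<sigma>(y := d)) A \<in> w)"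
  using world_All_elim[OF assms] world_All_intro[OF assms] by blast

lemma world_Ex:
  assumes w: "world w" and \<sigma>: "admissible \<sigma>"
  shows "emb \<sigma> (Ex y A) \<in> w \<longleftrightarrow>
    \<sigma> ` (FV A - {y}) \<subseteq> params w \<and> (\<exists>d\<in>params w. emb (\<sigma>(y := d)) A \<in> w)"
proof (cases "\<sigma> ` (FV A - {y}) \<subseteq> params w")
  case True
  let ?All = "emb \<sigma> (All y (Neg A))"
  have FV: "FV (emb \<sigma> (Ex y A)) \<subseteq> params w" "FV (Neg ?All) \<subseteq> params w"
    using True by (simp_all only: FV_emb[OF \<sigma>] FV.simps)
  have "\<turnstile> Imp (emb \<sigma> (Ex y A)) (Neg ?All)" "\<turnstile> Imp (Neg ?All) (emb \<sigma> (Ex y A))"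
    using provable_Ex_iff[of "\<rho> y" "emb (\<sigma>(y := \<rho> y)) A"]
    by (auto intro: provable_by_taut[of "[Iff (emb \<sigma> (Ex y A)) (Neg ?All)]"])
  then have "emb \<sigma> (Ex y A) \<in> w \<longleftrightarrow> Neg ?All \<in> w"
    using world_provable_imp[OF w] FV by blast
  also have "\<dots> \<longleftrightarrow> \<not> (\<forall>d\<in>params w. Neg (emb (\<sigma>(y := d)) A) \<in> w)"
    using True world_Neg[OF w \<sigma>, of "All y (Neg A)"] world_All[OF w \<sigma>, of y "Neg A"] by simp
  also have "\<dots> \<longleftrightarrow> (\<exists>d\<in>params w. emb (\<sigma>(y := d)) A \<in> w)"
  proof -
    have "Neg (emb (\<sigma>(y := d)) A) \<in> w \<longleftrightarrow> emb (\<sigma>(y := d)) A \<notin> w" if "d \<in> params w" for d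
      unfolding world_Neg[OF w admissible_upd_param[OF \<sigma> w that]] using True that by auto
    then show ?thesis by blast
  qed
  finally show ?thesis using True by simp
next
  case False
  then show ?thesis using emb_mem_params[OF \<sigma>, of "Ex y A" w] by auto
qed

end

section \<open>Modalities in worlds\<close>

definition alls :: "var list \<Rightarrow> fm \<Rightarrow> fm" where
  "alls ys A = foldr All ys A"

lemma alls_simps [simp]: "alls [] A = A" "alls (y # ys) A = All y (alls ys A)"
  by (simp_all add: alls_def)

lemma FV_alls [simp]: "FV (alls ys A) = FV A - set ys"
  by (induction ys) auto

lemma variants_empty: "variants \<nu> {} D = {\<nu>}"
  by (auto simp: variants_def)

lemma variants_insert: "variants \<nu> (insert y Y) D = (\<Union>d\<in>D. variants (\<nu>(y := d)) Y D)"
proof (intro equalityI subsetI)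
  fix \<mu> assume "\<mu> \<in> variants \<nu> (insert y Y) D"
  then have "\<mu> \<in> variants (\<nu>(y := \<mu> y)) Y D" "\<mu> y \<in> D" by (auto simp: variants_def)
  then show "\<mu> \<in> (\<Union>d\<in>D. variants (\<nu>(y := d)) Y D)" by blast
qed (auto simp: variants_def split: if_splits)

lemma obtain_bound_list:
  obtains ys where "set ys = FV A - fset X"
  using finite_list[OF finite_Diff[OF finite_FV]] by blast

context folp
begin

definition accessible :: "fm set \<Rightarrow> fm set \<Rightarrow> bool" where
  "accessible w u \<longleftrightarrow> params w \<subseteq> params u \<and> boxes w \<subseteq> u"

lemma accessible_refl: "accessible w w"
  by (auto simp: accessible_def boxes_def)

lemma accessible_trans: "accessible w u \<Longrightarrow> accessible u v \<Longrightarrow> accessible w v"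
  unfolding accessible_def boxes_def by blast

lemma accessible_Box: "accessible w u \<Longrightarrow> Box X A \<in> w \<Longrightarrow> Box X A \<in> u"
  unfolding accessible_def boxes_def by blast

lemma accessible_Just:
  assumes "saturated w" and "saturated u" and "accessible w u" and mem: "Just t X A \<in> w"
  shows "Just t X A \<in> u"
proof -
  have FV: "fset X \<subseteq> params w" using FV_subset_params[OF mem] by simp
  have "Just (Bang t) X (Just t X A) \<in> w"
    by (rule saturated_provable_imp[OF assms(1) Axiom[OF A6] mem]) (simp add: FV)
  then have "Box X (Just t X A) \<in> w"
    by (rule saturated_provable_imp[OF assms(1) Axiom[OF A8]]) (simp add: FV)
  then have "Box X (Just t X A) \<in> u" by (rule accessible_Box[OF assms(3)])
  then show ?thesis
    by (rule saturated_provable_imp[OF assms(2) Axiom[OF A3']])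
      (use FV assms(3) in \<open>auto simp: accessible_def\<close>)
qed

end

context folp_embedding
begin

lemma world_alls:
  assumes w: "world w"
  shows "admissible \<sigma> \<Longrightarrow>
    emb \<sigma> (alls ys A) \<in> w \<longleftrightarrow> (\<forall>\<mu>\<in>variants \<sigma> (set ys) (params w). emb \<mu> A \<in> w)"
proof (induction ys arbitrary: \<sigma>)
  case Nil
  then show ?case by (simp add: variants_empty)
next
  case (Cons y ys)
  have "emb \<sigma> (alls (y # ys) A) \<in> w \<longleftrightarrow> (\<forall>d\<in>params w. emb (\<sigma>(y := d)) (alls ys A) \<in> w)"
    by (simp only: alls_simps world_All[OF w Cons.prems])
  also have "\<dots> \<longleftrightarrow> (\<forall>d\<in>params w. \<forall>\<mu>\<in>variants (\<sigma>(y := d)) (set ys) (params w). emb \<mu> A \<in> w)"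
    using Cons.IH[OF admissible_upd_param[OF Cons.prems w]] by blast
  also have "\<dots> \<longleftrightarrow> (\<forall>\<mu>\<in>variants \<sigma> (set (y # ys)) (params w). emb \<mu> A \<in> w)"
    by (simp add: variants_insert)
  finally show ?case .
qed

lemma provable_alls_elim: "\<turnstile> Imp (emb \<sigma> (alls ys A)) (emb (override_on \<sigma> \<rho> (set ys)) A)"
proof (induction ys arbitrary: \<sigma>)
  case Nil
  then show ?case by (simp add: provable_imp_refl)
next
  case (Cons y ys)
  have "\<turnstile> Imp (emb (\<sigma>(y := \<rho> y)) (alls ys A)) (emb (override_on \<sigma> \<rho> (set (y # ys))) A)"
    using Cons[of "\<sigma>(y := \<rho> y)"] by (simp only: override_on_insert' list.set)
  then show ?case using provable_imp_trans[OF provable_All_elim] by simp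
qed

lemma provable_Box_alls:
  assumes "admissible \<sigma>" and "set ys \<inter> fset X = {}"
  shows "\<turnstile> Imp (emb \<sigma> (Box X A)) (emb \<sigma> (Box X (alls ys A)))"
  using assms(2)
proof (induction ys)
  case Nil
  then show ?case by (simp add: provable_imp_refl)
next
  case (Cons y ys)
  let ?\<sigma> = "override_on \<rho> \<sigma> (fset X)"
  have "\<rho> y |\<notin>| \<sigma> |`| X"
    using admissible_neq[OF assms(1), of _ y] Cons.prems by force
  then have "\<turnstile> Imp (Box (\<sigma> |`| X) (emb ?\<sigma> (alls ys A)))
      (Box (\<sigma> |`| X) (All (\<rho> y) (emb ?\<sigma> (alls ys A))))"
    by (intro Axiom A7')
  moreover have "?\<sigma>(y := \<rho> y) = ?\<sigma>" using Cons.prems by (auto simp: override_on_def)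
  ultimately have "\<turnstile> Imp (emb \<sigma> (Box X (alls ys A))) (emb \<sigma> (Box X (alls (y # ys) A)))"
    by (simp only: ren.simps alls_simps)
  then show ?case using Cons provable_imp_trans by auto
qed

lemma world_Box_elim:
  assumes w: "world w" and \<sigma>: "admissible \<sigma>" and mem: "emb \<sigma> (Box X A) \<in> w"
    and u: "accessible w u" "world u" and \<mu>: "\<mu> \<in> variants \<sigma> (FV A - fset X) (params u)"
  shows "emb \<mu> A \<in> u"
proof -
  obtain ys where ys: "set ys = FV A - fset X" by (rule obtain_bound_list)
  have "\<turnstile> Imp (emb \<sigma> (Box X A)) (emb \<sigma> (Box X (alls ys A)))"
    using ys by (intro provable_Box_alls[OF \<sigma>]) auto
  moreover have "emb (override_on \<rho> \<sigma> (fset X)) (alls ys A) = emb \<sigma> (alls ys A)"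
    by (rule ren_free_cong) (use ys in auto)
  then have "\<turnstile> Imp (emb \<sigma> (Box X (alls ys A))) (emb \<sigma> (alls ys A))"
    using Axiom[OF A3'] by simp
  ultimately have "\<turnstile> Imp (emb \<sigma> (Box X A)) (emb \<sigma> (alls ys A))" by (rule provable_imp_trans)
  moreover have box: "emb \<sigma> (Box X A) \<in> u"
    using accessible_Box[OF u(1)] mem by simp
  moreover have "FV (emb \<sigma> (alls ys A)) \<subseteq> params u"
    using emb_mem_params[OF \<sigma> box] ys by (auto simp: FV_emb[OF \<sigma>])
  ultimately have "emb \<sigma> (alls ys A) \<in> u" using world_provable_imp[OF u(2)] by blast
  then show ?thesis using world_alls[OF u(2) \<sigma>] \<mu> ys by auto
qed

lemma ex_accessible_world_omitting:
  assumes "world w" and "FV A \<subseteq> params w" and "\<not> boxes w \<tturnstile> A"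
  shows "\<exists>u. world u \<and> accessible w u \<and> A \<notin> u"
proof -
  have "params (boxes w) \<union> FV A \<subseteq> params w"
    using assms(2) by (auto simp: params_def boxes_def)
  then show ?thesis
    using ex_world_omitting[OF assms(3), of "params w"] assms(1)
    unfolding world_def accessible_def by blast
qed

lemma world_Box_intro:
  assumes w: "world w" and \<sigma>: "admissible \<sigma>" and X: "\<sigma> ` fset X \<subseteq> params w"
    and all: "\<And>u \<mu>. world u \<Longrightarrow> accessible w u \<Longrightarrow> \<mu> \<in> variants \<sigma> (FV A - fset X) (params u) \<Longrightarrow>
      emb \<mu> A \<in> u"
  shows "emb \<sigma> (Box X A) \<in> w"
proof -
  obtain ys where ys: "set ys = FV A - fset X" by (rule obtain_bound_list)
  let ?D = "emb \<sigma> (alls ys A)"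
  have FV: "FV ?D \<subseteq> \<sigma> ` fset X" unfolding FV_emb[OF \<sigma>] using ys by auto
  have "?D \<in> u" if "world u" "accessible w u" for u
    using all that world_alls[OF that(1) \<sigma>] ys by simp
  then have "boxes w \<tturnstile> ?D"
    using ex_accessible_world_omitting[OF w] FV X by blast
  then have "Box (\<sigma> |`| X) ?D \<in> w"
    using FV X by (intro saturated_Box_if_boxes_entail[OF world_saturated[OF w]]) simp_all
  moreover have "emb (override_on \<sigma> \<rho> (set ys)) A = emb (override_on \<rho> \<sigma> (fset X)) A"
    by (rule ren_free_cong) (use ys in \<open>auto simp: override_on_def\<close>)
  then have "\<turnstile> Imp ?D (emb (override_on \<rho> \<sigma> (fset X)) A)"
    using provable_alls_elim[of \<sigma> ys A] by simp
  then have "Box (\<sigma> |`| X) (Imp ?D (emb (override_on \<rho> \<sigma> (fset X)) A)) \<in> w"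
    using X by (intro saturated_Box_provable[OF world_saturated[OF w]]) auto
  ultimately show ?thesis
    using saturated_Box_MP[OF world_saturated[OF w]] by simp
qed

lemma world_Box:
  assumes "world w" and "admissible \<sigma>"
  shows "emb \<sigma> (Box X A) \<in> w \<longleftrightarrow> \<sigma> ` fset X \<subseteq> params w \<and>
    (\<forall>u. world u \<and> accessible w u \<longrightarrow> (\<forall>\<mu>\<in>variants \<sigma> (FV A - fset X) (params u). emb \<mu> A \<in> u))"
  (is "?L \<longleftrightarrow> ?R")
proof
  assume L: ?L
  then have "\<sigma> ` fset X \<subseteq> params w" using emb_mem_params[OF assms(2) L] by simp
  then show ?R using world_Box_elim[OF assms L] by blast
next
  assume R: ?R
  then show ?L by (intro world_Box_intro[OF assms]) blast+
qed

lemma world_Just_restrict: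
  assumes w: "world w" and \<sigma>: "admissible \<sigma>" and "emb \<sigma> (Just t Y A) \<in> w"
    and XY: "X |\<subseteq>| Y" and FV: "FV A \<inter> fset Y \<subseteq> fset X"
  shows "emb \<sigma> (Just t X A) \<in> w"
proof -
  let ?A = "emb (override_on \<rho> \<sigma> (fset X)) A"
  define Z where "Z = (\<sigma> |`| Y) |-| (\<sigma> |`| X)"
  have "emb (override_on \<rho> \<sigma> (fset Y)) A = ?A"
    by (rule ren_free_cong) (use FV XY in \<open>auto simp: less_eq_fset.rep_eq override_on_def\<close>)
  moreover have "\<sigma> |`| X |\<union>| Z = \<sigma> |`| Y" using XY by (auto simp: Z_def)
  ultimately have mem: "Just (ren_term \<rho> t) (\<sigma> |`| X |\<union>| Z) ?A \<in> w"
    using assms(3) by simp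
  have "override_on \<rho> \<sigma> (fset X) x \<notin> fset Z" if "x \<in> FV A" for x
  proof (cases "x |\<in>| X")
    case False
    then have "\<rho> x \<notin> \<sigma> ` fset Y"
      using FV that admissible_neq[OF \<sigma>, of _ x] by force
    then show ?thesis using False by (simp add: Z_def)
  qed (simp add: Z_def)
  then have "fset Z \<inter> FV ?A = {}"
    unfolding FV_emb[OF admissible_override[OF \<sigma>]] by auto
  then have "Just (ren_term \<rho> t) (\<sigma> |`| X) ?A \<in> w"
    by (intro world_provable_imp[OF w provable_Just_restrict mem])
      (use FV_subset_params[OF mem] in auto)
  then show ?thesis by simp
qed

text \<open>Substitution for a variable bound by the modality: adding \<open>\<rho> y\<close> to the index set frees it
  in the conclusion only, so it can be generalized and instantiated there.\<close>

lemma provable_Just_insert: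
  assumes \<sigma>: "admissible \<sigma>" and "\<sigma> y \<notin> range \<rho>" and "y |\<notin>| X"
  shows "\<turnstile> Imp (emb \<sigma> (Just t X A)) (emb \<sigma> (Just t (finsert y X) A))"
proof -
  let ?\<sigma> = "\<sigma>(y := \<rho> y)" and ?B = "Imp (Just t X A) (Just t (finsert y X) A)"
  have "override_on \<rho> ?\<sigma> (fset (finsert y X)) = override_on \<rho> ?\<sigma> (fset X)"
    using assms(3) by (auto simp: override_on_def)
  then have "\<turnstile> emb ?\<sigma> ?B"
    using Axiom[OF A2] by simp
  then have "\<turnstile> subst (id(\<rho> y := \<sigma> y)) (emb ?\<sigma> ?B)"
    using emb_instance(1)[OF \<sigma> assms(2)] by (rule provable_subst)
  then show ?thesis using emb_instance(2)[OF \<sigma> assms(2), of y ?B] by simp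
qed

lemma world_Just_extend:
  assumes w: "world w" and \<sigma>: "admissible \<sigma>" and mem: "emb \<sigma> (Just t X A) \<in> w"
  shows "\<sigma> ` fset Z \<subseteq> params w \<Longrightarrow> emb \<sigma> (Just t (X |\<union>| Z) A) \<in> w"
proof (induction Z)
  case empty
  then show ?case using mem by simp
next
  case (insert z Z)
  then have IH: "emb \<sigma> (Just t (X |\<union>| Z) A) \<in> w" by simp
  show ?case
  proof (cases "z |\<in>| X")
    case True
    then have "X |\<union>| finsert z Z = X |\<union>| Z" by auto
    then show ?thesis using IH by simp
  next
    case False
    have "\<sigma> z \<notin> range \<rho>" using insert.prems param_notin_range[OF w] by simp
    then have "\<turnstile> Imp (emb \<sigma> (Just t (X |\<union>| Z) A)) (emb \<sigma> (Just t (finsert z (X |\<union>| Z)) A))"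
      using False insert.hyps by (intro provable_Just_insert[OF \<sigma>]) auto
    moreover have "FV (emb \<sigma> (Just t (finsert z (X |\<union>| Z)) A)) \<subseteq> params w"
      using emb_mem_params[OF \<sigma> IH] insert.prems by (auto simp: FV_emb[OF \<sigma>])
    ultimately have "emb \<sigma> (Just t (finsert z (X |\<union>| Z)) A) \<in> w"
      using world_provable_imp[OF w] IH by blast
    then show ?thesis by simp
  qed
qed

end

section \<open>Evidence\<close>

context folp_embedding
begin

text \<open>A variable outside the domain of \<open>f\<close> keeps its copy under \<open>\<rho>\<close>, which is bound in the
  justification formulas considered below.\<close>

definition completion :: "(var \<rightharpoonup> var) \<Rightarrow> var \<Rightarrow> var" where
  "completion f x = (case f x of Some d \<Rightarrow> d | None \<Rightarrow> \<rho> x)"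

lemma completion_Some: "f x = Some d \<Longrightarrow> completion f x = d"
  by (simp add: completion_def)

lemma Some_completion: "x \<in> dom f \<Longrightarrow> f x = Some (completion f x)"
  by (auto simp: completion_def)

lemma completion_image_subset: "S \<subseteq> dom f \<Longrightarrow> completion f ` S \<subseteq> ran f"
  by (fastforce simp: completion_def ran_def dom_def)

lemma admissible_completion:
  assumes "world w" and "ran f \<subseteq> params w"
  shows "admissible (completion f)"
  unfolding admissible_def
proof
  fix x
  show "completion f x = \<rho> x \<or> completion f x \<notin> range \<rho>"
  proof (cases "f x")
    case (Some d)
    then have "d \<in> params w" using assms(2) by (auto intro: ranI)
    then show ?thesis using Some param_notin_range[OF assms(1)] by (simp add: completion_def)
  qed (simp add: completion_def)
qed

definition evidence :: "jterm \<Rightarrow> fm \<Rightarrow> (var \<rightharpoonup> var) \<Rightarrow> fm set \<Rightarrow> bool" where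
  "evidence t A f w \<longleftrightarrow> ran f \<subseteq> params w \<and>
     (\<exists>X. fset X = FV A \<inter> dom f \<and> emb (completion f) (Just t X A) \<in> w)"

lemma emb_Just_cong:
  "(\<And>x. x |\<in>| X \<Longrightarrow> \<sigma> x = \<sigma>' x) \<Longrightarrow> emb \<sigma> (Just t X A) = emb \<sigma>' (Just t X A)"
  by (rule ren_free_cong) simp

lemma evidence_iff_exact:
  assumes X: "fset X = FV A \<inter> dom f"
  shows "evidence t A f w \<longleftrightarrow> ran f \<subseteq> params w \<and> emb (completion f) (Just t X A) \<in> w"
  unfolding evidence_def X[symmetric] fset_inject by blast

lemma evidence_iff:
  assumes w: "world w" and \<sigma>: "admissible \<sigma>" and ran: "ran f \<subseteq> params w"
    and X: "fset X \<inter> FV A = dom f \<inter> FV A" "\<sigma> ` fset X \<subseteq> params w"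
    and f: "\<And>x. x \<in> FV A \<inter> dom f \<Longrightarrow> f x = Some (\<sigma> x)"
  shows "evidence t A f w \<longleftrightarrow> emb \<sigma> (Just t X A) \<in> w"
proof -
  obtain Y where Y: "fset Y = FV A \<inter> dom f" by (rule obtain_fset_FV_Int)
  have sub: "Y |\<subseteq>| X" using X(1) Y by (auto simp: less_eq_fset.rep_eq)
  have "emb (completion f) (Just t Y A) = emb \<sigma> (Just t Y A)"
    using Y f by (intro emb_Just_cong completion_Some) simp
  then have "evidence t A f w \<longleftrightarrow> emb \<sigma> (Just t Y A) \<in> w"
    using evidence_iff_exact[OF Y] ran by simp
  also have "\<dots> \<longleftrightarrow> emb \<sigma> (Just t X A) \<in> w"
  proof
    assume "emb \<sigma> (Just t Y A) \<in> w"
    then have "emb \<sigma> (Just t (Y |\<union>| X) A) \<in> w"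
      by (rule world_Just_extend[OF w \<sigma> _ X(2)])
    then show "emb \<sigma> (Just t X A) \<in> w" using sub by (simp only: sup.absorb2)
  next
    assume "emb \<sigma> (Just t X A) \<in> w"
    then show "emb \<sigma> (Just t Y A) \<in> w"
      by (rule world_Just_restrict[OF w \<sigma> _ sub]) (use Y X(1) in blast)
  qed
  finally show ?thesis .
qed

lemma evidence_iff_completion:
  assumes w: "world w" and f: "ran f \<subseteq> params w"
    and X: "dom f \<inter> FV A \<subseteq> fset X" "fset X \<subseteq> dom f"
  shows "evidence t A f w \<longleftrightarrow> emb (completion f) (Just t X A) \<in> w"
  using X f completion_image_subset[OF X(2)]
  by (intro evidence_iff[OF w admissible_completion[OF w f] f] Some_completion) auto

lemma evidence_accessible:
  assumes "world w" and "world u" and "accessible w u" and "evidence t A f w"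
  shows "evidence t A f u"
proof -
  obtain X where X: "fset X = FV A \<inter> dom f" "emb (completion f) (Just t X A) \<in> w"
    and ran: "ran f \<subseteq> params w"
    using assms(4) unfolding evidence_def by blast
  have "emb (completion f) (Just t X A) \<in> u"
    using X(2) accessible_Just[OF world_saturated world_saturated, OF assms(1-3)] by simp
  then show ?thesis
    using X(1) ran assms(3) unfolding evidence_def accessible_def by blast
qed

lemma evidence_extend:
  assumes w: "world w" and evidence_f: "evidence t A f w" and g: "f \<subseteq>\<^sub>m g" "ran g \<subseteq> params w"
  shows "evidence t A g w"
proof -
  obtain X where X: "fset X = FV A \<inter> dom f" by (rule obtain_fset_FV_Int)
  obtain Z where Z: "fset Z = FV A \<inter> dom g" by (rule obtain_fset_FV_Int)
  have agree: "f x = g x" if "x \<in> dom f" for x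
    using g(1) that by (simp add: map_le_def)
  have "emb (completion f) (Just t X A) = emb (completion g) (Just t X A)"
    using X agree by (intro emb_Just_cong) (auto simp: completion_def)
  then have "emb (completion g) (Just t X A) \<in> w"
    using evidence_f evidence_iff_exact[OF X] by simp
  then have "emb (completion g) (Just t (X |\<union>| Z) A) \<in> w"
    using completion_image_subset[of "fset Z" g] Z g(2)
    by (intro world_Just_extend[OF w admissible_completion[OF w g(2)]]) auto
  moreover have "X |\<union>| Z = Z"
    using X Z map_le_implies_dom_le[OF g(1)] by (auto simp: fset_eq_iff)
  ultimately show ?thesis using evidence_iff_exact[OF Z] g(2) by simp
qed

lemma evidence_restrict:
  assumes "evidence t A f w"
  shows "evidence t A (f |` FV A) w"
proof -
  obtain X where X: "fset X = FV A \<inter> dom f" "emb (completion f) (Just t X A) \<in> w"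
    and ran: "ran f \<subseteq> params w"
    using assms unfolding evidence_def by blast
  have "emb (completion (f |` FV A)) (Just t X A) \<in> w"
    using X emb_Just_cong[of X "completion (f |` FV A)" "completion f"]
    by (simp add: completion_def)
  moreover have "fset X = FV A \<inter> dom (f |` FV A)" using X(1) by auto
  moreover have "ran (f |` FV A) \<subseteq> params w"
    using ran by (auto simp: ran_def restrict_map_def)
  ultimately show ?thesis unfolding evidence_def by blast
qed

lemma evidence_App:
  assumes w: "world w" and t: "evidence t (Imp A B) f w" and s: "evidence s A f w"
  shows "evidence (App t s) B f w"
proof -
  have ran: "ran f \<subseteq> params w" using t unfolding evidence_def by blast
  obtain X where X: "fset X = FV (Imp A B) \<inter> dom f" by (rule obtain_fset_FV_Int)
  note evidence_iff_X = evidence_iff_completion[OF w ran, of _ X]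
  let ?emb = "emb (completion f)"
  have t: "?emb (Just t X (Imp A B)) \<in> w" and s: "?emb (Just s X A) \<in> w"
    using t s evidence_iff_X[of "Imp A B" t] evidence_iff_X[of A s] X by auto
  have FV: "fset (completion f |`| X) \<subseteq> params w" using FV_subset_params[OF s] by simp
  have "Imp (?emb (Just s X A)) (?emb (Just (App t s) X B)) \<in> w"
    unfolding ren.simps ren_term.simps
    by (rule world_provable_imp[OF w Axiom[OF A4] t[unfolded ren.simps]])
      (use FV in simp)
  then have "?emb (Just (App t s) X B) \<in> w"
    using world_MP[OF w] s by blast
  then show ?thesis using evidence_iff_X[of B "App t s"] X by auto
qed

lemma evidence_Sum:
  assumes w: "world w" and "evidence t A f w \<or> evidence s A f w"
  shows "evidence (Sum t s) A f w"
proof -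
  have "Just (Sum t' s') Y B \<in> w" if "Just t' Y B \<in> w \<or> Just s' Y B \<in> w" for t' s' Y B
    using that
  proof
    assume mem: "Just t' Y B \<in> w"
    show ?thesis
      by (rule world_provable_imp[OF w Axiom[OF A5_left] mem])
        (use FV_subset_params[OF mem] in simp)
  next
    assume mem: "Just s' Y B \<in> w"
    show ?thesis
      by (rule world_provable_imp[OF w Axiom[OF A5_right] mem])
        (use FV_subset_params[OF mem] in simp)
  qed
  then show ?thesis using assms(2) unfolding evidence_def ren.simps ren_term.simps by blast
qed

lemma evidence_Bang:
  assumes w: "world w" and evidence_f: "evidence t A f w" and g: "f \<subseteq>\<^sub>m g" "ran g \<subseteq> params w"
    and X: "dom f \<inter> FV A \<subseteq> fset X" "fset X \<subseteq> dom g"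
  shows "evidence (Bang t) (Just t X A) g w"
proof -
  let ?g = "g |` fset X" and ?J = "emb (completion g) (Just t X A)"
  have "f |` FV A \<subseteq>\<^sub>m ?g"
    using g(1) X by (auto simp: map_le_def restrict_map_def)
  moreover have ran: "ran ?g \<subseteq> params w"
    using g(2) by (auto simp: ran_def restrict_map_def)
  ultimately have "evidence t A ?g w"
    by (rule evidence_extend[OF w evidence_restrict[OF evidence_f]])
  then have "emb (completion ?g) (Just t X A) \<in> w"
    using evidence_iff_completion[OF w ran, of A X t] X by auto
  moreover have "emb (completion ?g) (Just t X A) = ?J"
    by (rule emb_Just_cong) (simp add: completion_def)
  ultimately have mem: "?J \<in> w" by simp
  have "Just (Bang (ren_term \<rho> t)) (completion g |`| X) ?J \<in> w"
    using mem unfolding ren.simps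
    by (rule world_provable_imp[OF w Axiom[OF A6]])
      (use FV_subset_params[OF mem] in simp)
  moreover have "emb (override_on \<rho> (completion g) (fset X)) (Just t X A) = ?J"
    by (rule emb_Just_cong) simp
  ultimately have "emb (completion g) (Just (Bang t) X (Just t X A)) \<in> w"
    by (simp only: ren.simps(10)[of \<rho> "completion g" "Bang t"] ren_term.simps)
  then show ?thesis
    using evidence_iff_completion[OF w g(2), of "Just t X A" X] X(2) by simp
qed

lemma evidence_Gen:
  assumes w: "world w" and evidence_f: "evidence t A f w" and x: "x \<notin> dom f \<inter> FV A"
  shows "evidence (Gen x t) (All x A) f w"
proof -
  let ?\<sigma> = "completion f"
  obtain X where X: "fset X = FV A \<inter> dom f" and mem: "emb ?\<sigma> (Just t X A) \<in> w"
    and ran: "ran f \<subseteq> params w"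
    using evidence_f unfolding evidence_def by blast
  have FV: "fset (?\<sigma> |`| X) \<subseteq> params w" using FV_subset_params[OF mem] by simp
  then have "\<rho> x |\<notin>| ?\<sigma> |`| X" using param_notin_range[OF w] by blast
  then have "Just (Gen (\<rho> x) (ren_term \<rho> t)) (?\<sigma> |`| X)
      (All (\<rho> x) (emb (override_on \<rho> ?\<sigma> (fset X)) A)) \<in> w"
    using FV mem unfolding ren.simps
    by (intro world_provable_imp[OF w Axiom[OF A7]]) simp_all
  moreover have "x |\<notin>| X" using X x by auto
  then have "(override_on \<rho> ?\<sigma> (fset X))(x := \<rho> x) = override_on \<rho> ?\<sigma> (fset X)"
    by (simp add: fun_upd_idem)
  ultimately have "emb ?\<sigma> (Just (Gen x t) X (All x A)) \<in> w" by simp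
  moreover have "fset X = FV (All x A) \<inter> dom f" using X x by auto
  ultimately show ?thesis using ran unfolding evidence_def by blast
qed

lemma evidence_subst:
  assumes free: "free_for \<sigma> A" and dom: "\<sigma> ` {x. \<sigma> x \<noteq> x} \<subseteq> dom f"
  shows "evidence t (subst \<sigma> A) (f |` FV (subst \<sigma> A)) w \<longleftrightarrow> evidence t A ((f \<circ> \<sigma>) |` FV A) w"
proof -
  let ?f = "f |` FV (subst \<sigma> A)" and ?g = "(f \<circ> \<sigma>) |` FV A"
  have FV: "FV (subst \<sigma> A) = \<sigma> ` FV A" by (rule FV_subst[OF free])
  obtain X where X: "fset X = FV A \<inter> dom ?g" by (rule obtain_fset_FV_Int)
  have \<sigma>X: "fset (\<sigma> |`| X) = FV (subst \<sigma> A) \<inter> dom ?f"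
    unfolding fimage.rep_eq X FV by (auto simp: dom_def restrict_map_def)
  have on_X: "completion ?f (\<sigma> x) = completion ?g x" if "x |\<in>| X" for x
    using that X FV by (auto simp: completion_def)
  have off_X: "\<sigma> x = x" "\<sigma> x \<notin> \<sigma> ` fset X" if "x \<in> FV A" "x |\<notin>| X" for x
    using that X dom by (auto simp: dom_def restrict_map_def)
  have "emb (override_on \<rho> (completion ?f) (fset (\<sigma> |`| X))) (subst \<sigma> A)
      = emb (override_on \<rho> (completion ?g) (fset X)) A"
    unfolding ren_subst[OF free]
    by (rule ren_free_cong) (use on_X off_X in \<open>auto simp: override_on_def\<close>)
  moreover have "completion ?f |`| \<sigma> |`| X = completion ?g |`| X"
    unfolding fset.map_comp by (rule fset.map_cong[OF refl]) (simp add: on_X)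
  ultimately have "emb (completion ?f) (Just t (\<sigma> |`| X) (subst \<sigma> A))
      = emb (completion ?g) (Just t X A)"
    by (simp only: ren.simps)
  moreover have "ran ?f = ran ?g"
    unfolding FV by (auto simp: ran_def restrict_map_def split: if_splits)
  ultimately show ?thesis
    using evidence_iff_exact[OF \<sigma>X] evidence_iff_exact[OF X] by simp
qed

lemma world_Just:
  assumes w: "world w" and \<sigma>: "admissible \<sigma>"
  shows "emb \<sigma> (Just t X A) \<in> w \<longleftrightarrow>
    emb \<sigma> (Box X A) \<in> w \<and> evidence t A ((Some \<circ> \<sigma>) |` (FV A \<inter> fset X)) w"
proof -
  let ?f = "(Some \<circ> \<sigma>) |` (FV A \<inter> fset X)"
  have box: "emb \<sigma> (Box X A) \<in> w" if mem: "emb \<sigma> (Just t X A) \<in> w"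
    by (rule world_provable_imp[OF w _ mem])
      (use Axiom[OF A8] FV_subset_params[OF mem] in simp_all)
  have "evidence t A ?f w \<longleftrightarrow> emb \<sigma> (Just t X A) \<in> w" if "emb \<sigma> (Box X A) \<in> w"
  proof (rule evidence_iff[OF w \<sigma>])
    show X: "\<sigma> ` fset X \<subseteq> params w" using emb_mem_params[OF \<sigma> that] by simp
    then show "ran ?f \<subseteq> params w" by (auto simp: ran_def restrict_map_def split: if_splits)
  qed (auto simp: restrict_map_def dom_def split: if_splits)
  then show ?thesis using box by blast
qed

end

section \<open>The canonical model\<close>

text \<open>Every set of numbers decodes to a set of formulas, so the canonical worlds need no
  well-formedness condition.\<close>

definition decode :: "nat set \<Rightarrow> fm set" where
  "decode s = {A. to_nat A \<in> s}"

lemma decode_image: "decode (to_nat ` w) = w"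
  by (auto simp: decode_def)

context folp_embedding
begin

definition canonical_model :: "(nat set, nat) fmodel" where
  "canonical_model = \<lparr>
     Worlds = {s. world (decode s)},
     Acc = {(s, s'). world (decode s) \<and> world (decode s') \<and> accessible (decode s) (decode s')},
     Dm = (\<lambda>s. params (decode s)),
     Intp = (\<lambda>P n s. {ds. length ds = n \<and> Atom P ds \<in> decode s}),
     Evid = (\<lambda>t A f. {s. world (decode s) \<and> evidence t A f (decode s)})\<rparr>"

lemma canonical_model_simps [simp]:
  "s \<in> Worlds canonical_model \<longleftrightarrow> world (decode s)"
  "(s, s') \<in> Acc canonical_model \<longleftrightarrow>
     world (decode s) \<and> world (decode s') \<and> accessible (decode s) (decode s')"
  "Dm canonical_model s = params (decode s)"
  "ds \<in> Intp canonical_model P n s \<longleftrightarrow> length ds = n \<and> Atom P ds \<in> decode s"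
  "s \<in> Evid canonical_model t A f \<longleftrightarrow> world (decode s) \<and> evidence t A f (decode s)"
  by (simp_all add: canonical_model_def)

lemma frame_cond_canonical_model:
  assumes "world w"
  shows "frame_cond canonical_model"
proof -
  have "to_nat ` w \<in> Worlds canonical_model" using assms by (simp add: decode_image)
  then have "Worlds canonical_model \<noteq> {}" by blast
  moreover have "refl_on (Worlds canonical_model) (Acc canonical_model)"
    by (auto simp: refl_on_def accessible_refl)
  moreover have "trans (Acc canonical_model)"
    by (auto simp: trans_def intro: accessible_trans)
  moreover have "Intp canonical_model P n s \<subseteq> {ds. length ds = n \<and> set ds \<subseteq> params (decode s)}"
    for P n s
    using FV_subset_params[of "Atom P _" "decode s"] by fastforce
  ultimately show ?thesis
    unfolding frame_cond_def by (auto simp: world_params_nonempty accessible_def)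
qed

lemma fitting_model_canonical_model:
  assumes "world w"
  shows "fitting_model canonical_model"
  unfolding fitting_model_def
proof (intro conjI)
  show "frame_cond canonical_model" by (rule frame_cond_canonical_model[OF assms])
  show "adequacy_cond canonical_model"
    unfolding adequacy_cond_def by (auto simp: evidence_def)
  show "substitution_cond canonical_model"
    unfolding substitution_cond_def set_eq_iff by (auto simp: evidence_subst)
  show "R_closure_cond canonical_model"
    unfolding R_closure_cond_def by (auto intro: evidence_accessible)
  show "extension_cond canonical_model"
    unfolding extension_cond_def by (auto intro: evidence_extend simp: ext_def fin_val_def)
  show "restriction_cond canonical_model"
    unfolding restriction_cond_def by (auto intro: evidence_restrict)
  show "app_cond canonical_model"
    unfolding app_cond_def by (auto intro: evidence_App)
  show "sum_cond canonical_model"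
    unfolding sum_cond_def by (auto intro: evidence_Sum)
  show "bang_cond canonical_model"
    unfolding bang_cond_def by (auto intro: evidence_Bang simp: ext_def fin_val_def)
  show "gen_cond canonical_model"
    unfolding gen_cond_def by (auto intro: evidence_Gen)
qed

lemma meets_canonical_model:
  assumes "ren \<rho> \<rho> ` C \<subseteq> CS"
  shows "meets canonical_model C"
  unfolding meets_def
proof (intro allI impI set_eqI iffI)
  fix c A s assume mem: "Just (JConst c) {||} A \<in> C" and "s \<in> Worlds canonical_model"
  then have w: "world (decode s)" by simp
  have "emb \<rho> (Just (JConst c) {||} A) \<in> CS" using assms mem by blast
  then have "emb \<rho> (Just (JConst c) {||} A) \<in> decode s"
    by (intro world_closed[OF w] entails_provable ConstSpec) simp_all
  moreover have "completion Map.empty = \<rho>" by (auto simp: completion_def)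
  ultimately show "s \<in> Evid canonical_model (JConst c) A Map.empty"
    using w evidence_iff_exact[of "{||}" A Map.empty] by simp
qed simp

lemma range_upd_param:
  "range \<nu> \<inter> range \<rho> = {} \<Longrightarrow> world w \<Longrightarrow> d \<in> params w \<Longrightarrow> range (\<nu>(x := d)) \<inter> range \<rho> = {}"
  using param_notin_range by (fastforce split: if_splits)

lemma truth_Box:
  assumes IH: "\<And>\<nu> s. range \<nu> \<inter> range \<rho> = {} \<Longrightarrow> world (decode s) \<Longrightarrow>
      sat canonical_model \<nu> s A \<longleftrightarrow> emb \<nu> A \<in> decode s"
    and \<nu>: "range \<nu> \<inter> range \<rho> = {}" and s: "world (decode s)"
  shows "sat canonical_model \<nu> s (Box X A) \<longleftrightarrow> emb \<nu> (Box X A) \<in> decode s"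
proof -
  let ?V = "\<lambda>u. variants \<nu> (FV A - fset X) (params u)"
  have "range \<mu> \<inter> range \<rho> = {}" if "world u" "\<mu> \<in> ?V u" for \<mu> u
  proof -
    have "range \<mu> \<subseteq> params u \<union> range \<nu>"
      using that(2) unfolding variants_def by auto
    then show ?thesis using \<nu> param_notin_range[OF that(1)] by blast
  qed
  then have "sat canonical_model \<mu> u A \<longleftrightarrow> emb \<mu> A \<in> decode u"
    if "world (decode u)" "\<mu> \<in> ?V (decode u)" for u \<mu>
    using IH that by blast
  then have "sat canonical_model \<nu> s (Box X A) \<longleftrightarrow> \<nu> ` fset X \<subseteq> params (decode s) \<and>
      (\<forall>u. world (decode u) \<and> accessible (decode s) (decode u) \<longrightarrow>
        (\<forall>\<mu>\<in>?V (decode u). emb \<mu> A \<in> decode u))"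
    using s by auto
  also have "\<dots> \<longleftrightarrow> \<nu> ` fset X \<subseteq> params (decode s) \<and>
      (\<forall>u. world u \<and> accessible (decode s) u \<longrightarrow> (\<forall>\<mu>\<in>?V u. emb \<mu> A \<in> u))"
    by (metis decode_image)
  also have "\<dots> \<longleftrightarrow> emb \<nu> (Box X A) \<in> decode s"
    by (rule world_Box[OF s admissible_if_disjoint[OF \<nu>], symmetric])
  finally show ?thesis .
qed

lemma truth:
  assumes "range \<nu> \<inter> range \<rho> = {}" and "world (decode s)"
  shows "sat canonical_model \<nu> s A \<longleftrightarrow> emb \<nu> A \<in> decode s"
  using assms
proof (induction A arbitrary: \<nu> s)
  case (All x A)
  then have "sat canonical_model (\<nu>(x := a)) s A \<longleftrightarrow> emb (\<nu>(x := a)) A \<in> decode s"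
    if "a \<in> params (decode s)" for a
    using that range_upd_param by (intro All.IH) simp_all
  then show ?case
    using world_All[OF All.prems(2) admissible_if_disjoint[OF All.prems(1)], of x A] by simp
next
  case (Ex x A)
  then have "sat canonical_model (\<nu>(x := a)) s A \<longleftrightarrow> emb (\<nu>(x := a)) A \<in> decode s"
    if "a \<in> params (decode s)" for a
    using that range_upd_param by (intro Ex.IH) simp_all
  then show ?case
    using world_Ex[OF Ex.prems(2) admissible_if_disjoint[OF Ex.prems(1)], of x A] by simp
next
  case (Box X A)
  show ?case by (rule truth_Box[OF Box.IH Box.prems])
next
  case (Just t X A)
  have "sat canonical_model \<nu> s (Just t X A) \<longleftrightarrow> sat canonical_model \<nu> s (Box X A) \<and>
      evidence t A ((Some \<circ> \<nu>) |` (FV A \<inter> fset X)) (decode s)"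
    using Just.prems(2) by simp
  also have "\<dots> \<longleftrightarrow> emb \<nu> (Just t X A) \<in> decode s"
    by (simp only: truth_Box[OF Just.IH Just.prems]
        world_Just[OF Just.prems(2) admissible_if_disjoint[OF Just.prems(1)]])
  finally show ?case .
qed (simp_all add: world_Neg world_Conj world_Disj world_Imp world_Iff admissible_if_disjoint)

lemma ex_countermodel:
  assumes "ren \<rho> \<rho> ` C \<subseteq> CS" and "\<forall>\<Psi>\<in>\<Gamma>. closed_fm \<Psi>" and "closed_fm \<Phi>"
    and "\<not> ren \<rho> \<rho> ` \<Gamma> \<tturnstile> ren \<rho> \<rho> \<Phi>"
  shows "\<exists>(M :: (nat set, nat) fmodel) \<nu> w.
    fitting_model M \<and> meets M C \<and> valuation M \<nu> \<and> w \<in> Worlds M \<and>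
    (\<forall>\<Psi>\<in>\<Gamma>. sat M \<nu> w \<Psi>) \<and> \<not> sat M \<nu> w \<Phi>"
proof -
  have closed: "FV (ren \<rho> \<rho> A) = {}" if "closed_fm A" for A
    using that by (simp add: FV_ren_inj inj closed_fm_def)
  then obtain w where w: "world w" "ren \<rho> \<rho> ` \<Gamma> \<subseteq> w" "ren \<rho> \<rho> \<Phi> \<notin> w"
    using ex_world_omitting[OF assms(4), of "{}"] assms(2,3) coinfinite by (auto simp: params_def)
  obtain a where a: "a \<in> params w" using world_params_nonempty[OF w(1)] by blast
  let ?w = "to_nat ` w" and ?\<nu> = "\<lambda>_ :: var. a"
  have w_mem: "?w \<in> Worlds canonical_model" using w(1) by (simp add: decode_image)
  have sat: "sat canonical_model ?\<nu> ?w A \<longleftrightarrow> ren \<rho> \<rho> A \<in> w" if "closed_fm A" for A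
  proof -
    have "emb ?\<nu> A = ren \<rho> \<rho> A"
      by (rule ren_free_cong) (use that in \<open>simp add: closed_fm_def\<close>)
    then show ?thesis
      using truth[of ?\<nu> ?w A] param_notin_range[OF w(1) a] w(1) by (simp add: decode_image)
  qed
  have "a \<in> Dm canonical_model ?w" using a by (simp add: decode_image)
  then have "valuation canonical_model ?\<nu>"
    using w_mem unfolding valuation_def Domain_of_def by blast
  moreover have "\<forall>\<Psi>\<in>\<Gamma>. sat canonical_model ?\<nu> ?w \<Psi>" using sat assms(2) w(2) by blast
  moreover have "\<not> sat canonical_model ?\<nu> ?w \<Phi>" using sat assms(3) w(3) by blast
  ultimately show ?thesis
    using fitting_model_canonical_model[OF w(1)] meets_canonical_model[OF assms(1)] w_mem by blast
qed

end

lemma infinite_compl_range_double: "infinite (- range (\<lambda>x :: nat. 2 * x))"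
proof -
  have "infinite (range (\<lambda>x :: nat. Suc (2 * x)))"
    by (rule range_inj_infinite) (simp add: inj_def)
  moreover have "range (\<lambda>x :: nat. Suc (2 * x)) \<subseteq> - range (\<lambda>x. 2 * x)"
    by (auto; presburger)
  ultimately show ?thesis using infinite_super by blast
qed

theorem mainTheorem2:
  fixes CS \<Gamma> :: "fm set" and \<Phi> :: fm
  assumes "const_spec CS"
    and "\<forall>\<Psi>\<in>\<Gamma>. closed_fm \<Psi>"
    and "closed_fm \<Phi>"
    and "\<not> derives CS \<Gamma> \<Phi>"
  shows "\<exists>(M :: (nat set, nat) fmodel) \<nu> w.
           fitting_model M \<and> meets M CS \<and> valuation M \<nu> \<and> w \<in> Worlds M \<and>
           (\<forall>\<Psi>\<in>\<Gamma>. sat M \<nu> w \<Psi>) \<and> \<not> sat M \<nu> w \<Phi>"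
proof -
  define \<rho> :: "var \<Rightarrow> var" where "\<rho> x = 2 * x" for x
  have inj: "inj \<rho>" and coinfinite: "infinite (- range \<rho>)"
    using infinite_compl_range_double by (simp_all add: \<rho>_def[abs_def] inj_def)
  interpret folp_embedding "ren \<rho> \<rho> ` CS" \<rho>
    by standard (use const_spec_ren[OF inj assms(1)] inj coinfinite in auto)
  have "\<not> entails CS \<Gamma> \<Phi>"
    using derives_if_entails assms(2,4) by blast
  then have "\<not> entails (ren \<rho> \<rho> ` CS) (ren \<rho> \<rho> ` \<Gamma>) (ren \<rho> \<rho> \<Phi>)"
    using entails_renD[OF inj] by blast
  then show ?thesis
    by (rule ex_countermodel[OF subset_refl assms(2,3)])
qed

end
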